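(* Assume the setting and Assumption (DG) described in the context, with true task $\theta^*\in\Theta$ and reference task $\bar\theta\in\Theta$ with $\pi(\bar\theta)>0$. Then for any $r\in(0,1)$ and any $T\ge1$, with $Z=z_{1:T}\sim p_T(\cdot\mid\theta^* )$, $$\mathbb{E}_{Z}\Big[\mathbb{E}_{\theta\sim\pi_T(\cdot\mid Z)}\big[D_{r,T}(\theta,\theta^* )\big]\Big] \le -\frac{1+r}{(1-r)T}\log\Big(\mathbb{E}_{\theta\sim\pi}\Big[\exp\Big(-\mathbb{E}_{Z}\Big[\log\frac{p_T(Z\mid\bar\theta)}{p_T(Z\mid\theta)}\Big]\Big)\Big]\Big) +\frac{1+r}{1-r}\,\frac{\mathrm{KL}\big(p_T(\cdot\mid\theta^* )\,\|\,p_T(\cdot\mid\bar\theta)\big)}{T}+O\Big(\frac{\log T}{T}\Big),$$ where the constants hidden in $O(\cdot)$ do not depend on $\pi$ or $T$.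
   Context: Setting. Tasks live in $\Theta\subset\mathbb{R}^{d}$; samples live in $\mathbb{R}^{d_z}$; $\|\cdot\|$ is the Euclidean norm and $B(0,R)$ the closed Euclidean ball of radius $R$ centered at $0$. For each $\theta\in\Theta$, $t\ge1$ and $z_{1:t-1}$, $p_t(\cdot\mid z_{1:t-1},\theta)$ is a probability density; the sequence is generated by $z_t\sim p_t(\cdot\mid z_{1:t-1},\theta)$ and $p_T(z_{1:T}\mid\theta)=\prod_{t=1}^T p_t(z_t\mid z_{1:t-1},\theta)$. $\pi$ is a probability density on $\Theta$ (the prior) and $\pi_T(\theta\mid z_{1:T})\propto\pi(\theta)p_T(z_{1:T}\mid\theta)$ is the posterior. For $r\in(0,1)$ the per-sample Rényi divergence is $$D_{r,T}(\theta,\theta^* )=-\frac{1}{T(1-r)}\log\mathbb{E}_{Z\sim p_T(\cdot\mid\theta^* )}\Big[\prod_{t=1}^T\Big(\frac{p_t(z_t\mid z_{1:t-1},\theta)}{p_t(z_t\mid z_{1:t-1},\theta^* )}\Big)^{r}\Big].$$ $\mathrm{KL}$ is the Kullback–Leibler divergence. "$\mathrm{poly}(x)$" denotes a quantity bounded by a polynomial in $x$ whose coefficients do not depend on the prior $\pi$ nor on $T$. Assumption (DG). Fix the true task $\theta^*\in\Theta$ and a reference task $\bar\theta\in\Theta$ with $\pi(\bar\theta)>0$. (i) Tails: there is $k\ge1$ such that for all $T\ge1$ and $R\ge T$, with $Z=z_{1:T}\sim p_T(\cdot\mid\theta^* )$: $\mathbb{P}\big(\sup_{\theta:\|\theta\|\ge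 R}p_T(Z\mid\theta)\ge p_T(Z\mid\bar\theta)\big)\le\frac{\mathrm{poly}(T)}{1+R^{1/k}}$ and $\mathbb{P}(\exists t\le T:\|z_t\|\ge R)\le\frac{\mathrm{poly}(T)}{1+R^{1/k}}$. (ii) Moments: for all $T\ge1$, $\mathbb{E}_{Z\sim p_T(\cdot\mid\theta^* )}\big[\log^2\big(\sup_{\theta\in\Theta}\frac{p_T(Z\mid\theta)}{p_T(Z\mid\bar\theta)}\big)\big]\le\mathrm{poly}(T)$. (iii) Regularity: for all $t\ge1$, $R>0$ and $\theta,\theta'\in\Theta\cap B(0,R)$, $\sup_{z_{1:t}\in B(0,R)^t}\log\frac{p_t(z_t\mid z_{1:t-1},\theta)}{p_t(z_t\mid z_{1:t-1},\theta')}\le\mathrm{poly}(R)\|\theta-\theta'\|$. *)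

theory Defs
  imports "HOL-Probability.Probability" "HOL-Computational_Algebra.Polynomial"
begin

(* Model: p t h \<theta> z is the conditional density p_{t+1}(z | z_{1:t}, \<theta>) (time is 0-indexed:
   samples are z_0, ..., z_{T-1}); the history h is always passed restricted to {..<t}. *)

definition seq_dens ::
  "(nat \<Rightarrow> (nat \<Rightarrow> 'z) \<Rightarrow> 'a \<Rightarrow> 'z \<Rightarrow> real) \<Rightarrow> nat \<Rightarrow> 'a \<Rightarrow> (nat \<Rightarrow> 'z) \<Rightarrow> real" where
  "seq_dens p T \<theta> Z = (\<Prod>t<T. p t (restrict Z {..<t}) \<theta> (Z t))"

definition seq_law ::
  "(nat \<Rightarrow> (nat \<Rightarrow> 'z::euclidean_space) \<Rightarrow> 'a \<Rightarrow> 'z \<Rightarrow> real) \<Rightarrow> nat \<Rightarrow> 'a \<Rightarrow> (nat \<Rightarrow> 'z) measure" where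
  "seq_law p T \<theta> = density (PiM {..<T} (\<lambda>_. lborel)) (\<lambda>Z. ennreal (seq_dens p T \<theta> Z))"

definition renyi_T ::
  "(nat \<Rightarrow> (nat \<Rightarrow> 'z::euclidean_space) \<Rightarrow> 'a \<Rightarrow> 'z \<Rightarrow> real) \<Rightarrow> real \<Rightarrow> nat \<Rightarrow> 'a \<Rightarrow> 'a \<Rightarrow> ennreal" where
  "renyi_T p r T \<theta> \<theta>s =
     (let A = (\<integral>\<^sup>+ Z. ennreal (\<Prod>t<T. (p t (restrict Z {..<t}) \<theta> (Z t)
                                        / p t (restrict Z {..<t}) \<theta>s (Z t)) powr r)
               \<partial>seq_law p T \<theta>s)
      in if A = 0 then \<infinity> else ennreal (- ln (enn2real A) / (real T * (1 - r))))"

definition post_expect ::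
  "(nat \<Rightarrow> (nat \<Rightarrow> 'z) \<Rightarrow> 'a::euclidean_space \<Rightarrow> 'z \<Rightarrow> real) \<Rightarrow> 'a set \<Rightarrow> ('a \<Rightarrow> real) \<Rightarrow> nat
     \<Rightarrow> (nat \<Rightarrow> 'z) \<Rightarrow> ('a \<Rightarrow> ennreal) \<Rightarrow> ennreal" where
  "post_expect p \<Theta> \<pi> T Z f =
     (\<integral>\<^sup>+ \<theta>. indicator \<Theta> \<theta> * ennreal (\<pi> \<theta> * seq_dens p T \<theta> Z) * f \<theta> \<partial>lborel)
     / (\<integral>\<^sup>+ \<theta>. indicator \<Theta> \<theta> * ennreal (\<pi> \<theta> * seq_dens p T \<theta> Z) \<partial>lborel)"

(* exp( - E_{Z ~ p_T(.|\<theta>s)} [ log (p_T(Z|\<theta>b) / p_T(Z|\<theta>)) ] ), with the convention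
   exp(-\<infinity>) = 0 when that expectation is +\<infinity> (i.e. p_T(Z|\<theta>) = 0 with positive
   probability, or the log-ratio is not integrable). *)
definition exp_neg_cross ::
  "(nat \<Rightarrow> (nat \<Rightarrow> 'z::euclidean_space) \<Rightarrow> 'a \<Rightarrow> 'z \<Rightarrow> real) \<Rightarrow> nat \<Rightarrow> 'a \<Rightarrow> 'a \<Rightarrow> 'a \<Rightarrow> real" where
  "exp_neg_cross p T \<theta>s \<theta>b \<theta> =
     (let f = (\<lambda>Z. ln (seq_dens p T \<theta>b Z / seq_dens p T \<theta> Z))
      in if (AE Z in seq_law p T \<theta>s. 0 < seq_dens p T \<theta> Z) \<and> integrable (seq_law p T \<theta>s) f
         then exp (- (\<integral>Z. f Z \<partial>seq_law p T \<theta>s)) else 0)"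

(* outer probability bound: P(E) \<le> b, for a possibly non-measurable event E *)
definition prob_le :: "'b measure \<Rightarrow> 'b set \<Rightarrow> real \<Rightarrow> bool" where
  "prob_le M E b \<longleftrightarrow> (\<exists>A\<in>sets M. E \<inter> space M \<subseteq> A \<and> measure M A \<le> b)"

end

theory Submission
  imports Defs
begin

text \<open>
  Regularity makes all the densities \<open>p_T(\<cdot> | \<theta>)\<close> share one support, so the log-likelihood ratios
  are real. Let \<open>H\<close> be the logarithm of the supremum of \<open>p_T(Z | \<theta>) / p_T(Z | \<theta>b)\<close> over \<open>\<Theta>\<close>.
  The change-of-measure inequality turns the posterior mean of \<open>T (1 - r) D_r\<close> into \<open>1 - r\<close> times
  the posterior mean of the log-likelihood ratio minus the log evidence. The former is at most the
  logarithm of the supremum of the likelihood ratio over \<open>\<Theta>\<close>, whose expectation \<open>E H - KL\<close> is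
  \<open>O(log T)\<close>: up to tails controlled by a second moment, the supremum is attained within a constant
  factor on a net of polynomial size. The log evidence is bounded by Jensen's inequality. This gives
  the theorem with factor 1 in place of \<open>1 + r\<close>, and the larger factor is harmless because
  \<open>KL - ln E\<pi> \<ge> 0\<close>.
\<close>

subsection \<open>Dominated families of densities\<close>

text \<open>The obstacle is the lack of boundedness: log-likelihood ratios need not be integrable
  for every parameter, and (DG) offers only tail probabilities and one second moment.
  \<open>H\<close> bounds every log ratio against \<open>g b\<close> from above; for the true
  parameter a bound from below comes from \<open>ln x \<le> x - 1\<close> applied to the mean-one
  ratio \<open>g b / g s\<close>, so KL is finite. For the supremum, a second moment at most
  \<open>Q\<close> is matched with a bad event of probability at most \<open>1 / Q\<close>, so that
  this event costs O(1). The radius that achieves this is polynomial in T and enters only through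
  the logarithm of the net size; this is the origin of log T. For the evidence, Jensen is applied
  not under the prior but under the prior reweighted by the exponential of the expected log ratio.
  The weight tames parameters whose expected log ratio is very negative, and after centring the
  exponent has mean zero over the sample, so only the normalising constant survives: the prior
  expectation in the statement.\<close>

locale density_family = base: sigma_finite_measure N
  for N :: "'b measure" +
  fixes g :: "'a \<Rightarrow> 'b \<Rightarrow> real" and s :: 'a
  assumes g_measurable [measurable]: "g \<theta> \<in> borel_measurable N"
    and g_nonneg [simp]: "0 \<le> g \<theta> Z"
    and g_int: "(\<integral>\<^sup>+ Z. ennreal (g \<theta> Z) \<partial>N) = 1"
    and g_supp: "Z \<in> space N \<Longrightarrow> 0 < g \<theta> Z \<Longrightarrow> 0 < g \<theta>' Z"
begin

definition law :: "'b measure" where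
  "law = density N (\<lambda>Z. ennreal (g s Z))"

lemma sets_law [simp, measurable_cong]: "sets law = sets N"
  by (simp add: law_def)

lemma space_law [simp]: "space law = space N"
  by (simp add: law_def)

sublocale law: prob_space law
  by standard (simp add: law_def emeasure_density nn_integral_set_ennreal[symmetric] g_int
      cong: nn_integral_cong)

lemma prob_space_law [simp]: "measure law (space N) = 1"
  using law.prob_space by simp

text \<open>Common support holds pointwise, so the zero set of \<open>g s\<close> is a single null
  set that serves uncountably many parameters at once.\<close>

lemma AE_law_pos: "AE Z in law. \<forall>\<theta>. 0 < g \<theta> Z"
  unfolding law_def by (subst AE_density) (auto intro: g_supp)

lemma nn_integral_ratio: "(\<integral>\<^sup>+ Z. ennreal (g \<theta> Z / g s Z) \<partial>law) = 1"
proof -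
  have "(\<integral>\<^sup>+ Z. ennreal (g \<theta> Z / g s Z) \<partial>law)
      = (\<integral>\<^sup>+ Z. ennreal (g s Z) * ennreal (g \<theta> Z / g s Z) \<partial>N)"
    unfolding law_def by (rule nn_integral_density) auto
  also have "\<dots> = (\<integral>\<^sup>+ Z. ennreal (g \<theta> Z) \<partial>N)"
  proof (rule nn_integral_cong)
    fix Z assume Z: "Z \<in> space N"
    \<comment> \<open>Where \<open>g s\<close> vanishes, so does \<open>g \<theta>\<close>. Hence no
      mass is lost and the ratio has mean exactly 1, not merely at most 1.\<close>
    have "g s Z * (g \<theta> Z / g s Z) = g \<theta> Z"
      using g_supp[OF Z, of \<theta> s] g_nonneg[of \<theta> Z] by (cases "g s Z = 0") (auto simp: less_le)
    then show "ennreal (g s Z) * ennreal (g \<theta> Z / g s Z) = ennreal (g \<theta> Z)"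
      by (simp flip: ennreal_mult)
  qed
  finally show ?thesis by (simp add: g_int)
qed

lemma integrable_ratio [simp]: "integrable law (\<lambda>Z. g \<theta> Z / g s Z)"
  by (rule integrableI_nonneg) (auto simp: nn_integral_ratio)

lemma integral_ratio [simp]: "(\<integral>Z. g \<theta> Z / g s Z \<partial>law) = 1"
  by (simp add: integral_eq_nn_integral nn_integral_ratio)

lemma integrable_cmult_ratio [simp]: "integrable law (\<lambda>Z. c * g \<theta> Z / g s Z)"
  using integrable_mult_right[OF integrable_ratio, of c] by simp

lemma integral_cmult_ratio [simp]: "(\<integral>Z. c * g \<theta> Z / g s Z \<partial>law) = c"
  using Bochner_Integration.integral_mult_right_zero[of law c "\<lambda>Z. g \<theta> Z / g s Z"] by simp

text \<open>\<open>KL_divergence\<close> takes the reference measure first, so the left-hand side is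
  KL(g s || g b).\<close>

lemma KL_eq:
  "KL_divergence (exp 1) (density N (\<lambda>Z. ennreal (g b Z))) law = (\<integral>Z. ln (g s Z / g b Z) \<partial>law)"
proof -
  have "KL_divergence (exp 1) (density N (\<lambda>Z. ennreal (g b Z))) law
      = (\<integral>Z. g s Z * log (exp 1) (g s Z / g b Z) \<partial>N)"
    unfolding law_def
  proof (rule base.KL_density_density)
    show "AE Z in N. g b Z = 0 \<longrightarrow> g s Z = 0"
      using g_supp[of _ s b] g_nonneg[of s] by (intro AE_I2) (metis less_eq_real_def less_irrefl)
  qed auto
  also have "\<dots> = (\<integral>Z. ln (g s Z / g b Z) \<partial>law)"
    unfolding law_def by (subst integral_real_density) (auto simp: log_def)
  finally show ?thesis .
qed

end

text \<open>\<open>H\<close> stands for the log of the supremum of the likelihood ratios but is only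
  required to dominate them; measurability of a supremum over an uncountable set is thereby
  postponed to the concrete model.\<close>

locale dominated_family = density_family N g s
  for N :: "'b measure" and g :: "'a \<Rightarrow> 'b \<Rightarrow> real" and s :: 'a +
  fixes b :: 'a and H :: "'b \<Rightarrow> real"
  assumes H_measurable [measurable]: "H \<in> borel_measurable N"
    and H_integrable: "integrable law H"
    and H_nonneg: "AE Z in law. 0 \<le> H Z"
    and H_dom: "AE Z in law. \<forall>\<theta>. g \<theta> Z \<le> exp (H Z) * g b Z"
begin

lemma AE_ln_le_H: "AE Z in law. \<forall>\<theta>. ln (g \<theta> Z / g b Z) \<le> H Z"
  using AE_law_pos H_dom
proof eventually_elim
  case (elim Z)
  show ?case
  proof
    fix \<theta>
    have "g \<theta> Z / g b Z \<le> exp (H Z)"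
      using elim by (simp add: pos_divide_le_eq)
    then have "ln (g \<theta> Z / g b Z) \<le> ln (exp (H Z))"
      using elim by (subst ln_le_cancel_iff) auto
    then show "ln (g \<theta> Z / g b Z) \<le> H Z" by simp
  qed
qed

definition kl :: real where
  "kl = (\<integral>Z. ln (g s Z / g b Z) \<partial>law)"

text \<open>From above the log ratio is at most \<open>H\<close>; its negative is at most
  \<open>g b / g s - 1\<close>, which has a finite mean.\<close>

lemma integrable_ln_ratio: "integrable law (\<lambda>Z. ln (g s Z / g b Z))"
proof (rule Bochner_Integration.integrable_bound)
  show "integrable law (\<lambda>Z. H Z + g b Z / g s Z)"
    using H_integrable by simp
  show "AE Z in law. norm (ln (g s Z / g b Z)) \<le> norm (H Z + g b Z / g s Z)"
    using AE_law_pos AE_ln_le_H H_nonneg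
  proof eventually_elim
    case (elim Z)
    have "ln (g b Z / g s Z) \<le> g b Z / g s Z - 1"
      using elim by (intro ln_le_minus_one) auto
    moreover have "ln (g s Z / g b Z) = - ln (g b Z / g s Z)"
      using elim by (simp add: ln_div)
    moreover have "0 \<le> g b Z / g s Z" by simp
    moreover have "ln (g s Z / g b Z) \<le> H Z" "0 \<le> H Z" using elim by auto
    ultimately show ?case unfolding real_norm_def by linarith
  qed
qed simp

text \<open>On the good event the log-likelihood ratio is controlled by a union bound over the net
  (through \<open>ln x \<le> ln n + x / n - 1\<close>), on the bad event by its second moment.\<close>

lemma expected_sup_log_ratio_le:
  fixes F :: "'a set" and Q :: real
  assumes F: "finite F" "F \<noteq> {}"
    and B [measurable]: "B \<in> sets N" and Q: "0 < Q" "measure law B \<le> 1 / Q"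
    and H2: "(\<integral>\<^sup>+ Z. ennreal ((H Z)\<^sup>2) \<partial>law) \<le> ennreal Q"
    and good: "AE Z in law. Z \<notin> B \<longrightarrow> exp (H Z) * g b Z \<le> exp 1 * (\<Sum>i\<in>F. g i Z)"
  shows "(\<integral>Z. H Z \<partial>law) - kl \<le> ln (real (card F)) + 3"
proof -
  define n where "n = real (card F)"
  have n: "1 \<le> n" using F by (simp add: n_def Suc_le_eq card_gt_0_iff)
  have H2i: "integrable law (\<lambda>Z. (H Z)\<^sup>2)"
    using le_less_trans[OF H2] by (intro integrableI_nonneg) auto
  have H2le: "(\<integral>Z. (H Z)\<^sup>2 \<partial>law) \<le> Q"
    using H2 Q by (subst (asm) nn_integral_eq_integral[OF H2i]) auto
  \<comment> \<open>One integrable majorant for both events, with all summands but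
    \<open>ln n\<close> nonnegative. The normalised sum and \<open>g b / g s\<close> have mean 1,
    and the middle term has mean at most (1 + 1) / 2; this gives the constant 3.\<close>
  define U where "U Z = ln n + (\<Sum>i\<in>F. g i Z / g s Z) / n
      + (Q * indicator B Z + (H Z)\<^sup>2 / Q) / 2 + g b Z / g s Z" for Z
  have Bi: "integrable law (indicat_real B)"
    by (simp add: integrable_indicator_iff less_top[symmetric])
  have Ui: "integrable law U"
    unfolding U_def using H2i Bi
    by (intro Bochner_Integration.integrable_add Bochner_Integration.integrable_sum
        integrable_divide_zero impI) auto
  have "(\<integral>Z. H Z - ln (g s Z / g b Z) \<partial>law) \<le> (\<integral>Z. U Z \<partial>law)"
  proof (rule integral_mono_AE)
    show "AE Z in law. H Z - ln (g s Z / g b Z) \<le> U Z"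
      using AE_law_pos H_nonneg good
    proof eventually_elim
      case (elim Z)
      have pos: "0 < g \<theta> Z" for \<theta> using elim by auto
      have eq: "ln (g s Z / g b Z) = - ln (g b Z / g s Z)"
        using pos by (simp add: ln_div)
      have sum_pos: "0 < (\<Sum>i\<in>F. g i Z)" using F pos by (intro sum_pos) auto
      have n0: "0 \<le> ln n" using n by simp
      have s0: "0 \<le> (\<Sum>i\<in>F. g i Z / g s Z) / n" using n by (intro divide_nonneg_nonneg sum_nonneg) auto
      have b0: "0 \<le> g b Z / g s Z" by simp
      have h0: "0 \<le> (Q * indicator B Z + (H Z)\<^sup>2 / Q) / 2" using Q by simp
      show ?case
      proof (cases "Z \<in> B")
        case True
        \<comment> \<open>Expanding this square is the arithmetic-geometric inequality that trades
          \<open>H\<close> for its square at scale \<open>Q\<close>.\<close>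
        have "0 \<le> (Q - H Z)\<^sup>2 / Q" using Q by simp
        also have "\<dots> = Q - 2 * H Z + (H Z)\<^sup>2 / Q"
          using Q by (simp add: power2_diff power2_eq_square field_simps)
        finally have "H Z \<le> (Q * indicator B Z + (H Z)\<^sup>2 / Q) / 2" using True by simp
        moreover have "ln (g b Z / g s Z) \<le> g b Z / g s Z - 1"
          using pos by (intro ln_le_minus_one) auto
        ultimately show ?thesis unfolding U_def eq using n0 s0 by linarith
      next
        case False
        have "exp (H Z) * g b Z / g s Z \<le> exp 1 * (\<Sum>i\<in>F. g i Z) / g s Z"
          using elim False pos[of s] by (intro divide_right_mono) auto
        then have "ln (exp (H Z) * g b Z / g s Z) \<le> ln (exp 1 * (\<Sum>i\<in>F. g i Z) / g s Z)"
          using pos sum_pos by (subst ln_le_cancel_iff) auto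
        moreover have "ln (exp (H Z) * g b Z / g s Z) = H Z + ln (g b Z / g s Z)"
          using pos[of s] pos[of b] by (simp add: ln_div ln_mult)
        \<comment> \<open>The 1 produced by the factor \<open>exp 1\<close> cancels against the -1
          in \<open>ln x \<le> x - 1\<close>.\<close>
        moreover have "ln (exp 1 * (\<Sum>i\<in>F. g i Z) / g s Z) = 1 + ln n + ln ((\<Sum>i\<in>F. g i Z) / g s Z / n)"
          using pos[of s] sum_pos n by (simp add: ln_div ln_mult)
        moreover have "ln ((\<Sum>i\<in>F. g i Z) / g s Z / n) \<le> (\<Sum>i\<in>F. g i Z) / g s Z / n - 1"
          using pos[of s] sum_pos n by (intro ln_le_minus_one) auto
        moreover have "(\<Sum>i\<in>F. g i Z / g s Z) / n = (\<Sum>i\<in>F. g i Z) / g s Z / n"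
          by (simp add: sum_divide_distrib)
        ultimately show ?thesis unfolding U_def eq using h0 b0 by linarith
      qed
    qed
  qed (use H_integrable integrable_ln_ratio Ui in auto)
  also have "(\<integral>Z. H Z - ln (g s Z / g b Z) \<partial>law) = (\<integral>Z. H Z \<partial>law) - kl"
    unfolding kl_def by (intro Bochner_Integration.integral_diff H_integrable integrable_ln_ratio)
  also have "(\<integral>Z. U Z \<partial>law) = ln n + 1 + (Q * measure law B + (\<integral>Z. (H Z)\<^sup>2 \<partial>law) / Q) / 2 + 1"
  proof -
    have "(\<integral>Z. (\<Sum>i\<in>F. g i Z / g s Z) / n \<partial>law) = 1"
      using F by (simp add: n_def)
    moreover have "(\<integral>Z. (Q * indicator B Z + (H Z)\<^sup>2 / Q) / 2 \<partial>law)
        = (Q * measure law B + (\<integral>Z. (H Z)\<^sup>2 \<partial>law) / Q) / 2"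
      using H2i Bi by simp
    ultimately show ?thesis
      unfolding U_def using H2i Bi by (simp add: law.prob_space)
  qed
  also have "\<dots> \<le> ln n + 3"
  proof -
    have "Q * measure law B \<le> 1" using Q by (simp add: field_simps)
    moreover have "(\<integral>Z. (H Z)\<^sup>2 \<partial>law) / Q \<le> 1" using Q H2le by simp
    ultimately show ?thesis by simp
  qed
  finally show ?thesis by (simp add: n_def)
qed

end

subsection \<open>Evidence and posterior\<close>

locale bayes_family = dominated_family N g s b H + prior: prob_space \<mu>
  for N :: "'b measure" and g :: "'a \<Rightarrow> 'b \<Rightarrow> real" and s b :: 'a and H :: "'b \<Rightarrow> real"
    and \<mu> :: "'a measure" +
  assumes g_joint: "case_prod g \<in> borel_measurable (\<mu> \<Otimes>\<^sub>M N)"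
begin

lemma g_joint_measurable [measurable (raw)]:
  assumes [measurable]: "u \<in> measurable L \<mu>" "v \<in> measurable L N"
  shows "(\<lambda>x. g (u x) (v x)) \<in> borel_measurable L"
  using measurable_compose[OF measurable_Pair[OF assms] g_joint] by simp

definition evid :: "'b \<Rightarrow> real" where
  "evid Z = enn2real (\<integral>\<^sup>+ \<theta>. ennreal (g \<theta> Z) \<partial>\<mu>)"

lemma evid_measurable [measurable]: "evid \<in> borel_measurable N"
  unfolding evid_def by measurable

text \<open>The evidence is finite because the envelope bounds all densities uniformly in the
  parameter, and positive because an integral of a positive function against a probability measure
  cannot vanish.\<close>

lemma AE_evid:
  "AE Z in law. Z \<in> space N \<and> 0 < evid Z \<and> (\<integral>\<^sup>+ \<theta>. ennreal (g \<theta> Z) \<partial>\<mu>) = ennreal (evid Z)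
     \<and> evid Z \<le> exp (H Z) * g b Z"
  using AE_law_pos H_dom AE_space[of law]
proof eventually_elim
  case (elim Z)
  have [measurable]: "Z \<in> space N" using elim by simp
  have "(\<integral>\<^sup>+ \<theta>. ennreal (g \<theta> Z) \<partial>\<mu>) \<le> (\<integral>\<^sup>+ \<theta>. ennreal (exp (H Z) * g b Z) \<partial>\<mu>)"
    using elim by (intro nn_integral_mono ennreal_leI) auto
  then have le: "(\<integral>\<^sup>+ \<theta>. ennreal (g \<theta> Z) \<partial>\<mu>) \<le> ennreal (exp (H Z) * g b Z)"
    by (simp add: prior.emeasure_space_1)
  have "(\<integral>\<^sup>+ \<theta>. ennreal (g \<theta> Z) \<partial>\<mu>) \<noteq> 0"
  proof
    assume "(\<integral>\<^sup>+ \<theta>. ennreal (g \<theta> Z) \<partial>\<mu>) = 0"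
    then have "AE \<theta> in \<mu>. ennreal (g \<theta> Z) = 0"
      by (subst (asm) nn_integral_0_iff_AE) auto
    then have "AE \<theta> in \<mu>. False"
      by eventually_elim (metis elim(1) ennreal_eq_0_iff not_le)
    then show False using prior.prob_space by simp
  qed
  moreover have "(\<integral>\<^sup>+ \<theta>. ennreal (g \<theta> Z) \<partial>\<mu>) \<noteq> \<top>"
    using le by (auto simp: top_unique)
  ultimately have "(\<integral>\<^sup>+ \<theta>. ennreal (g \<theta> Z) \<partial>\<mu>) = ennreal (evid Z)" "0 < evid Z"
    unfolding evid_def by (auto simp: less_le enn2real_eq_0_iff)
  then show ?case using le elim by auto
qed

section \<open>Expected log-likelihood ratios and the log evidence\<close>

definition mean_llr :: "'a \<Rightarrow> real" where
  "mean_llr \<theta> = (\<integral>Z. ln (g \<theta> Z / g b Z) \<partial>law)"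

text \<open>Since the log ratio is at most \<open>H\<close>, failure of integrability means that its
  expectation is minus infinity, so the value is 0. The case split keeps the default value 0 of the
  Bochner integral from producing \<open>exp 0 = 1\<close>.\<close>

definition exp_llr :: "'a \<Rightarrow> real" where
  "exp_llr \<theta> = (if integrable law (\<lambda>Z. ln (g \<theta> Z / g b Z)) then exp (mean_llr \<theta>) else 0)"

lemma mean_llr_measurable [measurable]: "mean_llr \<in> borel_measurable \<mu>"
  unfolding mean_llr_def by measurable

lemma exp_llr_measurable [measurable]: "exp_llr \<in> borel_measurable \<mu>"
proof -
  \<comment> \<open>Integrability is recast as finiteness of a nonnegative integral, which depends
    measurably on the parameter.\<close>
  have "exp_llr \<in> borel_measurable \<mu> \<longleftrightarrow> (\<lambda>\<theta>. if (\<integral>\<^sup>+ Z. ennreal \<bar>ln (g \<theta> Z / g b Z)\<bar> \<partial>law) < \<infinity>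
      then exp (mean_llr \<theta>) else 0) \<in> borel_measurable \<mu>"
    by (intro measurable_cong) (auto simp: exp_llr_def integrable_iff_bounded)
  also have "\<dots>" by measurable
  finally show ?thesis .
qed

lemma exp_llr_nonneg [simp]: "0 \<le> exp_llr \<theta>"
  by (simp add: exp_llr_def)

text \<open>Gibbs' inequality: the gap \<open>kl - mean_llr \<theta>\<close> is the mean of
  \<open>ln (g s / g \<theta>)\<close>, which is nonnegative because \<open>g \<theta> / g s\<close>
  has mean 1.\<close>

lemma mean_llr_le_kl:
  assumes "integrable law (\<lambda>Z. ln (g \<theta> Z / g b Z))"
  shows "mean_llr \<theta> \<le> kl"
proof -
  have "mean_llr \<theta> \<le> (\<integral>Z. (g \<theta> Z / g s Z - 1) + ln (g s Z / g b Z) \<partial>law)"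
    unfolding mean_llr_def
  proof (rule integral_mono_AE[OF assms])
    show "integrable law (\<lambda>Z. (g \<theta> Z / g s Z - 1) + ln (g s Z / g b Z))"
      using integrable_ln_ratio by simp
    show "AE Z in law. ln (g \<theta> Z / g b Z) \<le> (g \<theta> Z / g s Z - 1) + ln (g s Z / g b Z)"
      using AE_law_pos
    proof eventually_elim
      case (elim Z)
      have pos: "0 < g \<theta>' Z" for \<theta>' using elim by auto
      have "ln (g \<theta> Z / g s Z) \<le> g \<theta> Z / g s Z - 1"
        using pos by (intro ln_le_minus_one) auto
      moreover have "ln (g \<theta> Z / g b Z) = ln (g \<theta> Z / g s Z) + ln (g s Z / g b Z)"
        using pos[of s] pos[of b] pos[of \<theta>] by (simp add: ln_div)
      ultimately show ?case by simp
    qed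
  qed
  also have "\<dots> = kl"
    using integrable_ln_ratio by (simp add: kl_def law.prob_space)
  finally show ?thesis .
qed

lemma exp_llr_le: "exp_llr \<theta> \<le> exp kl"
  using mean_llr_le_kl[of \<theta>] by (simp add: exp_llr_def)

lemma nn_integral_exp_llr_le: "(\<integral>\<^sup>+ \<theta>. ennreal (exp_llr \<theta>) \<partial>\<mu>) \<le> ennreal (exp kl)"
proof -
  have "(\<integral>\<^sup>+ \<theta>. ennreal (exp_llr \<theta>) \<partial>\<mu>) \<le> (\<integral>\<^sup>+ \<theta>. ennreal (exp kl) \<partial>\<mu>)"
    by (intro nn_integral_mono ennreal_leI exp_llr_le)
  then show ?thesis by (simp add: prior.emeasure_space_1)
qed

text \<open>Supplies the integrability on the product space for Fubini. The deviation alone is not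
  uniformly bounded, as \<open>mean_llr\<close> can be arbitrarily negative; the weight
  \<open>exp (mean_llr \<theta>)\<close> compensates.\<close>

lemma exp_llr_deviation_le:
  "ennreal (exp_llr \<theta>) * (\<integral>\<^sup>+ Z. ennreal \<bar>ln (g \<theta> Z / g b Z) - mean_llr \<theta>\<bar> \<partial>law)
     \<le> ennreal (4 * (\<integral>Z. H Z \<partial>law) * exp kl + 2)"
proof (cases "integrable law (\<lambda>Z. ln (g \<theta> Z / g b Z))")
  case False
  then show ?thesis by (simp add: exp_llr_def)
next
  case True
  define h k where "h = (\<integral>Z. H Z \<partial>law)" and "k = mean_llr \<theta>"
  have h0: "0 \<le> h" unfolding h_def using H_nonneg by (rule integral_nonneg_AE)
  have kk: "(\<integral>Z. ln (g \<theta> Z / g b Z) \<partial>law) = k" by (simp add: k_def mean_llr_def)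
  have absX: "(\<integral>Z. \<bar>ln (g \<theta> Z / g b Z)\<bar> \<partial>law) \<le> 2 * h - k"
  proof -
    have "(\<integral>Z. \<bar>ln (g \<theta> Z / g b Z)\<bar> \<partial>law) \<le> (\<integral>Z. 2 * H Z - ln (g \<theta> Z / g b Z) \<partial>law)"
    proof (rule integral_mono_AE)
      \<comment> \<open>If x \<le> h and 0 \<le> h then |x| \<le> 2h - x, whatever the sign of x;
        the absolute mean is thus controlled by the mean itself.\<close>
      show "AE Z in law. \<bar>ln (g \<theta> Z / g b Z)\<bar> \<le> 2 * H Z - ln (g \<theta> Z / g b Z)"
        using AE_ln_le_H H_nonneg by eventually_elim (auto simp: abs_if dest: spec[of _ \<theta>])
    qed (use True H_integrable in auto)
    also have "\<dots> = 2 * h - k"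
      using True H_integrable by (simp add: kk h_def)
    finally show ?thesis .
  qed
  have "(\<integral>Z. \<bar>ln (g \<theta> Z / g b Z) - k\<bar> \<partial>law) \<le> (\<integral>Z. \<bar>ln (g \<theta> Z / g b Z)\<bar> + \<bar>k\<bar> \<partial>law)"
    using True by (intro integral_mono) auto
  also have "\<dots> = (\<integral>Z. \<bar>ln (g \<theta> Z / g b Z)\<bar> \<partial>law) + \<bar>k\<bar>"
    using True by (simp add: law.prob_space)
  also have "\<bar>k\<bar> \<le> (\<integral>Z. \<bar>ln (g \<theta> Z / g b Z)\<bar> \<partial>law)"
    unfolding kk[symmetric] by (rule integral_abs_bound)
  finally have dev: "(\<integral>Z. \<bar>ln (g \<theta> Z / g b Z) - k\<bar> \<partial>law) \<le> 4 * h - 2 * k"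
    using absX by simp
  have "exp k * (4 * h - 2 * k) \<le> 4 * h * exp kl + 2"
  proof -
    have "exp k * (4 * h) \<le> exp kl * (4 * h)"
      using mean_llr_le_kl[OF True] h0 by (intro mult_right_mono) (auto simp: k_def)
    \<comment> \<open>This bounds -k exp k by 1 even as k tends to minus infinity; doubled, it is
      the summand 2 of the bound.\<close>
    moreover have "exp k * (- k) \<le> exp k * exp (- k)"
      using exp_ge_add_one_self[of "-k"] by (intro mult_left_mono) auto
    then have "exp k * (- k) \<le> 1" by (simp flip: exp_add)
    ultimately show ?thesis by (simp add: algebra_simps)
  qed
  moreover have "exp k * (\<integral>Z. \<bar>ln (g \<theta> Z / g b Z) - k\<bar> \<partial>law) \<le> exp k * (4 * h - 2 * k)"
    using dev by (intro mult_left_mono) auto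
  ultimately have "exp k * (\<integral>Z. \<bar>ln (g \<theta> Z / g b Z) - k\<bar> \<partial>law) \<le> 4 * h * exp kl + 2"
    by linarith
  moreover have "(\<integral>\<^sup>+ Z. ennreal \<bar>ln (g \<theta> Z / g b Z) - k\<bar> \<partial>law)
      = ennreal (\<integral>Z. \<bar>ln (g \<theta> Z / g b Z) - k\<bar> \<partial>law)"
    using True by (intro nn_integral_eq_integral) auto
  ultimately show ?thesis
    using True by (simp add: exp_llr_def ennreal_leI flip: k_def h_def ennreal_mult)
qed

text \<open>Jensen's inequality for \<open>ln\<close> under the prior tilted by \<open>exp_llr\<close>, integrated over the
  sample by Fubini.\<close>

lemma
  assumes K: "0 < (\<integral>\<^sup>+ \<theta>. ennreal (exp_llr \<theta>) \<partial>\<mu>)"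
  defines "\<kappa> \<equiv> enn2real (\<integral>\<^sup>+ \<theta>. ennreal (exp_llr \<theta>) \<partial>\<mu>)"
  shows integrable_ln_evid: "integrable law (\<lambda>Z. ln (evid Z / g b Z))"
    and ln_le_integral_ln_evid: "ln \<kappa> \<le> (\<integral>Z. ln (evid Z / g b Z) \<partial>law)"
proof -
  have Kfin: "(\<integral>\<^sup>+ \<theta>. ennreal (exp_llr \<theta>) \<partial>\<mu>) < \<top>"
    using nn_integral_exp_llr_le by (rule le_less_trans) simp
  then have K_eq: "(\<integral>\<^sup>+ \<theta>. ennreal (exp_llr \<theta>) \<partial>\<mu>) = ennreal \<kappa>"
    by (simp add: \<kappa>_def)
  have \<kappa>: "0 < \<kappa>" using K Kfin by (simp add: \<kappa>_def enn2real_positive_iff)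
  \<comment> \<open>The tilted prior gives no mass to parameters with a non-integrable log ratio,
    since \<open>exp_llr\<close> is 0 there.\<close>
  define \<nu> where "\<nu> = density \<mu> (\<lambda>\<theta>. ennreal (exp_llr \<theta> / \<kappa>))"
  have sets_\<nu> [simp, measurable_cong]: "sets \<nu> = sets \<mu>" by (simp add: \<nu>_def)
  have "emeasure \<nu> (space \<nu>) = (\<integral>\<^sup>+ \<theta>. ennreal (exp_llr \<theta> / \<kappa>) \<partial>\<mu>)"
    by (auto simp: \<nu>_def emeasure_density intro!: nn_integral_cong)
  also have "\<dots> = (\<integral>\<^sup>+ \<theta>. ennreal (exp_llr \<theta>) / ennreal \<kappa> \<partial>\<mu>)"
    using \<kappa> by (simp add: divide_ennreal)
  also have "\<dots> = 1"
    by (subst nn_integral_divide) (use \<kappa> in \<open>auto simp: K_eq divide_ennreal\<close>)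
  finally interpret \<nu>: prob_space \<nu> by (rule prob_spaceI)
  interpret P: pair_sigma_finite \<nu> law ..
  have nn_\<nu>: "(\<integral>\<^sup>+ \<theta>. f \<theta> \<partial>\<nu>) = (\<integral>\<^sup>+ \<theta>. ennreal (exp_llr \<theta> / \<kappa>) * f \<theta> \<partial>\<mu>)"
    if "f \<in> borel_measurable \<mu>" for f
    unfolding \<nu>_def using that by (intro nn_integral_density) auto
  \<comment> \<open>Centring does two things: \<open>exp Y\<close> times the tilt weight gives back
    the likelihood ratio up to \<kappa>, and \<open>Y\<close> has sample mean 0 for almost every
    tilted parameter, whence \<open>J\<close> has mean 0.\<close>
  define Y where "Y \<theta> Z = ln (g \<theta> Z / g b Z) - mean_llr \<theta>" for \<theta> Z
  have Y_meas [measurable]: "case_prod Y \<in> borel_measurable (\<nu> \<Otimes>\<^sub>M law)"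
    unfolding Y_def by measurable
  have Y_int: "integrable (\<nu> \<Otimes>\<^sub>M law) (case_prod Y)"
  proof (rule integrableI_bounded[OF Y_meas])
    have "(\<integral>\<^sup>+ x. ennreal (norm (case_prod Y x)) \<partial>(\<nu> \<Otimes>\<^sub>M law))
        = (\<integral>\<^sup>+ \<theta>. \<integral>\<^sup>+ Z. ennreal \<bar>Y \<theta> Z\<bar> \<partial>law \<partial>\<nu>)"
      by (subst law.nn_integral_fst[symmetric]) auto
    also have "\<dots> = (\<integral>\<^sup>+ \<theta>. ennreal (exp_llr \<theta> / \<kappa>) * (\<integral>\<^sup>+ Z. ennreal \<bar>Y \<theta> Z\<bar> \<partial>law) \<partial>\<mu>)"
      by (intro nn_\<nu>) (unfold Y_def, measurable)
    also have "\<dots> \<le> (\<integral>\<^sup>+ \<theta>. ennreal (4 * (\<integral>Z. H Z \<partial>law) * exp kl + 2) * ennreal (1 / \<kappa>) \<partial>\<mu>)"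
    proof (rule nn_integral_mono)
      fix \<theta>
      have "ennreal (exp_llr \<theta> / \<kappa>) = ennreal (exp_llr \<theta>) * ennreal (1 / \<kappa>)"
        using \<kappa> by (simp flip: ennreal_mult)
      then have "ennreal (exp_llr \<theta> / \<kappa>) * (\<integral>\<^sup>+ Z. ennreal \<bar>Y \<theta> Z\<bar> \<partial>law)
          = ennreal (exp_llr \<theta>) * (\<integral>\<^sup>+ Z. ennreal \<bar>Y \<theta> Z\<bar> \<partial>law) * ennreal (1 / \<kappa>)"
        by (simp only: ac_simps)
      also have "\<dots> \<le> ennreal (4 * (\<integral>Z. H Z \<partial>law) * exp kl + 2) * ennreal (1 / \<kappa>)"
        unfolding Y_def by (intro mult_right_mono exp_llr_deviation_le) simp
      finally show "ennreal (exp_llr \<theta> / \<kappa>) * (\<integral>\<^sup>+ Z. ennreal \<bar>Y \<theta> Z\<bar> \<partial>law) \<le> \<dots>" .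
    qed
    also have "\<dots> < \<infinity>"
      by (simp add: prior.emeasure_space_1 ennreal_mult_less_top)
    finally show "(\<integral>\<^sup>+ x. ennreal (norm (case_prod Y x)) \<partial>(\<nu> \<Otimes>\<^sub>M law)) < \<infinity>" .
  qed
  define J where "J Z = (\<integral>\<theta>. Y \<theta> Z \<partial>\<nu>)" for Z
  have J_int: "integrable law J"
    unfolding J_def by (rule P.integrable_snd[OF Y_int])
  have "(\<integral>Z. J Z \<partial>law) = (\<integral>\<theta>. (\<integral>Z. Y \<theta> Z \<partial>law) \<partial>\<nu>)"
    unfolding J_def P.integral_snd[OF Y_int] P.integral_fst[OF Y_int] ..
  also have "\<dots> = (\<integral>\<theta>. 0 \<partial>\<nu>)"
  proof (rule integral_cong_AE)
    have "AE \<theta> in \<nu>. integrable law (\<lambda>Z. ln (g \<theta> Z / g b Z))"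
      unfolding \<nu>_def by (subst AE_density) (auto simp: exp_llr_def intro!: AE_I2)
    then show "AE \<theta> in \<nu>. (\<integral>Z. Y \<theta> Z \<partial>law) = 0"
      by eventually_elim (simp add: Y_def mean_llr_def law.prob_space)
  qed measurable
  finally have J0: "(\<integral>Z. J Z \<partial>law) = 0" by simp
  have lower: "AE Z in law. J Z + ln \<kappa> \<le> ln (evid Z / g b Z)"
    using P.AE_integrable_snd[OF Y_int] AE_law_pos AE_evid
  proof eventually_elim
    case (elim Z)
    have [measurable]: "Z \<in> space N" and pos: "0 < g \<theta> Z" and ev: "0 < evid Z" for \<theta>
      using elim by auto
    \<comment> \<open>Jensen in tangent form: with this shift \<open>exp (Y - l)\<close> has tilted
      mean at most 1, and \<open>x + 1 \<le> exp x\<close> then gives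
      \<open>J Z \<le> l\<close>.\<close>
    define l where "l = ln (evid Z / g b Z) - ln \<kappa>"
    have Yi: "integrable \<nu> (\<lambda>\<theta>. Y \<theta> Z)" using elim by simp
    have Ym [measurable]: "(\<lambda>\<theta>. Y \<theta> Z) \<in> borel_measurable \<mu>" unfolding Y_def by measurable
    have "(\<integral>\<^sup>+ \<theta>. ennreal (exp (Y \<theta> Z - l)) \<partial>\<nu>)
        = (\<integral>\<^sup>+ \<theta>. ennreal (exp_llr \<theta> / \<kappa>) * ennreal (exp (Y \<theta> Z - l)) \<partial>\<mu>)"
      by (intro nn_\<nu>) measurable
    \<comment> \<open>Equality holds where \<open>exp_llr\<close> is positive; the remaining
      parameters contribute 0 on the left and a positive amount on the right.\<close>
    also have "\<dots> \<le> (\<integral>\<^sup>+ \<theta>. ennreal (g \<theta> Z) / ennreal (evid Z) \<partial>\<mu>)"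
    proof (rule nn_integral_mono)
      fix \<theta>
      have "exp (- l) = g b Z * \<kappa> / evid Z"
        using pos[of b] ev \<kappa> by (simp add: l_def exp_diff exp_minus exp_add field_simps)
      moreover have "exp (Y \<theta> Z - l) = (g \<theta> Z / g b Z) / exp (mean_llr \<theta>) * exp (- l)"
        using pos[of \<theta>] pos[of b] by (simp add: Y_def exp_diff exp_minus exp_add field_simps)
      ultimately have E: "exp (Y \<theta> Z - l)
          = (g \<theta> Z / g b Z) / exp (mean_llr \<theta>) * (g b Z * \<kappa> / evid Z)" by simp
      have "exp_llr \<theta> / \<kappa> * exp (Y \<theta> Z - l) \<le> g \<theta> Z / evid Z"
        unfolding E using pos[of b] ev \<kappa> by (simp add: exp_llr_def)
      then show "ennreal (exp_llr \<theta> / \<kappa>) * ennreal (exp (Y \<theta> Z - l)) \<le> ennreal (g \<theta> Z) / ennreal (evid Z)"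
        using ev \<kappa> by (simp add: divide_ennreal ennreal_leI flip: ennreal_mult)
    qed
    also have "\<dots> = 1"
      by (subst nn_integral_divide) (use elim in \<open>auto simp: divide_ennreal\<close>)
    finally have le1: "(\<integral>\<^sup>+ \<theta>. ennreal (exp (Y \<theta> Z - l)) \<partial>\<nu>) \<le> 1" .
    have ei: "integrable \<nu> (\<lambda>\<theta>. exp (Y \<theta> Z - l))"
      using le_less_trans[OF le1] by (intro integrableI_nonneg) auto
    have "(\<integral>\<theta>. Y \<theta> Z - l + 1 \<partial>\<nu>) \<le> (\<integral>\<theta>. exp (Y \<theta> Z - l) \<partial>\<nu>)"
      using Yi ei by (intro integral_mono) (auto intro: order_trans[OF _ exp_ge_add_one_self])
    also have "\<dots> \<le> 1"
      using le1 by (subst (asm) nn_integral_eq_integral[OF ei]) auto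
    finally have "J Z - l \<le> 0"
      using Yi by (simp add: J_def \<nu>.prob_space)
    then show ?case by (simp add: l_def)
  qed
  \<comment> \<open>Together with \<open>lower\<close> this sandwiches the log evidence between
    integrable functions, which is how its integrability follows.\<close>
  have upper: "AE Z in law. ln (evid Z / g b Z) \<le> H Z"
    using AE_law_pos AE_evid
  proof eventually_elim
    case (elim Z)
    then have "evid Z / g b Z \<le> exp (H Z)" by (simp add: pos_divide_le_eq)
    then have "ln (evid Z / g b Z) \<le> ln (exp (H Z))"
      using elim by (subst ln_le_cancel_iff) auto
    then show ?case by simp
  qed
  show int: "integrable law (\<lambda>Z. ln (evid Z / g b Z))"
  proof (rule Bochner_Integration.integrable_bound)
    show "integrable law (\<lambda>Z. \<bar>J Z + ln \<kappa>\<bar> + \<bar>H Z\<bar>)" using J_int H_integrable by auto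
    show "AE Z in law. norm (ln (evid Z / g b Z)) \<le> norm (\<bar>J Z + ln \<kappa>\<bar> + \<bar>H Z\<bar>)"
      using lower upper by eventually_elim (unfold real_norm_def, linarith)
  qed measurable
  have "(\<integral>Z. J Z + ln \<kappa> \<partial>law) \<le> (\<integral>Z. ln (evid Z / g b Z) \<partial>law)"
    using J_int int lower by (intro integral_mono_AE) auto
  then show "ln \<kappa> \<le> (\<integral>Z. ln (evid Z / g b Z) \<partial>law)"
    using J_int J0 by (simp add: law.prob_space)
qed

end

section \<open>Renyi affinity and the change of measure\<close>

lemma powr_le_weighted_arith_mean:
  fixes x r :: real
  assumes "0 \<le> x" "0 < r" "r < 1"
  shows "x powr r \<le> r * x + (1 - r)"
proof (cases "x = 0")
  case False
  have "exp (r * ln x + (1 - r) * 0) \<le> r * exp (ln x) + (1 - r) * exp 0"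
    using convex_onD[OF exp_convex, of r 0 "ln x"] assms by (simp add: algebra_simps)
  then show ?thesis using False assms by (simp add: powr_def)
qed (use assms in auto)

context bayes_family
begin

text \<open>The Hellinger (Chernoff) affinity of order \<open>r\<close>; minus its logarithm is T (1
  - r) times the per-sample Renyi divergence.\<close>

definition affinity :: "real \<Rightarrow> 'a \<Rightarrow> real" where
  "affinity r \<theta> = (\<integral>Z. (g \<theta> Z / g s Z) powr r \<partial>law)"

lemma affinity_measurable [measurable]: "affinity r \<in> borel_measurable \<mu>"
  unfolding affinity_def by measurable

context
  fixes r :: real
  assumes r: "0 < r" "r < 1"
begin

lemma ratio_powr_le: "(g \<theta> Z / g s Z) powr r \<le> r * g \<theta> Z / g s Z + (1 - r)"
  using powr_le_weighted_arith_mean[OF _ r, of "g \<theta> Z / g s Z"] by simp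

lemma integrable_ratio_powr: "integrable law (\<lambda>Z. (g \<theta> Z / g s Z) powr r)"
proof (rule Bochner_Integration.integrable_bound)
  show "integrable law (\<lambda>Z. r * g \<theta> Z / g s Z + (1 - r))" by simp
  show "AE Z in law. norm ((g \<theta> Z / g s Z) powr r) \<le> norm (r * g \<theta> Z / g s Z + (1 - r))"
    using ratio_powr_le by (intro AE_I2) (auto intro: order_trans[OF _ abs_ge_self])
qed measurable

lemma affinity_le_1: "affinity r \<theta> \<le> 1"
proof -
  have "affinity r \<theta> \<le> (\<integral>Z. r * g \<theta> Z / g s Z + (1 - r) \<partial>law)"
    unfolding affinity_def using ratio_powr_le by (intro integral_mono integrable_ratio_powr) auto
  then show ?thesis by simp
qed

text \<open>Common support excludes mutual singularity, so the infinite branch of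
  \<open>renyi_T\<close> never occurs for parameters in \<Theta>.\<close>

lemma affinity_pos: "0 < affinity r \<theta>"
proof -
  have "affinity r \<theta> \<noteq> 0"
  proof
    assume "affinity r \<theta> = 0"
    then have "AE Z in law. (g \<theta> Z / g s Z) powr r = 0"
      unfolding affinity_def
      by (subst (asm) integral_nonneg_eq_0_iff_AE[OF integrable_ratio_powr]) auto
    then have "AE Z in law. False"
      using AE_law_pos by eventually_elim (simp add: less_le)
    then show False using law.prob_space by simp
  qed
  moreover have "0 \<le> affinity r \<theta>" unfolding affinity_def by (intro integral_nonneg_AE) auto
  ultimately show ?thesis by simp
qed

lemma nn_integral_ratio_powr:
  "(\<integral>\<^sup>+ Z. ennreal ((g \<theta> Z / g s Z) powr r) \<partial>law) = ennreal (affinity r \<theta>)"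
  unfolding affinity_def using integrable_ratio_powr by (intro nn_integral_eq_integral) auto

text \<open>The Donsker--Varadhan step, made pointwise by \<open>ln x \<le> x - 1\<close>: the weight
  \<open>(p\<^sub>\<theta> / p\<^sub>s) powr r / affinity\<close> has expectation 1 under the true law.\<close>

lemma posterior_renyi_le:
  assumes L: "integrable law (\<lambda>Z. ln (evid Z / g b Z))"
  shows "(\<integral>\<^sup>+ Z. (\<integral>\<^sup>+ \<theta>. ennreal (g \<theta> Z * - ln (affinity r \<theta>)) \<partial>\<mu>)
             / (\<integral>\<^sup>+ \<theta>. ennreal (g \<theta> Z) \<partial>\<mu>) \<partial>law)
      \<le> ennreal ((1 - r) * ((\<integral>Z. H Z \<partial>law) - kl) + kl - (\<integral>Z. ln (evid Z / g b Z) \<partial>law))"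
proof -
  interpret P: pair_sigma_finite \<mu> law ..
  define V where "V \<theta> Z = (g \<theta> Z / g s Z) powr r / affinity r \<theta>" for \<theta> Z
  have [measurable]: "case_prod V \<in> borel_measurable (\<mu> \<Otimes>\<^sub>M law)" unfolding V_def by measurable
  have V0: "0 \<le> V \<theta> Z" for \<theta> Z using affinity_pos[of \<theta>] by (simp add: V_def)
  have "(\<integral>\<^sup>+ Z. \<integral>\<^sup>+ \<theta>. ennreal (V \<theta> Z) \<partial>\<mu> \<partial>law) = (\<integral>\<^sup>+ \<theta>. \<integral>\<^sup>+ Z. ennreal (V \<theta> Z) \<partial>law \<partial>\<mu>)"
    by (rule P.Fubini') measurable
  also have "\<dots> = (\<integral>\<^sup>+ \<theta>. 1 \<partial>\<mu>)"
  proof (rule nn_integral_cong)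
    fix \<theta>
    have "(\<integral>\<^sup>+ Z. ennreal (V \<theta> Z) \<partial>law)
        = (\<integral>\<^sup>+ Z. ennreal ((g \<theta> Z / g s Z) powr r) / ennreal (affinity r \<theta>) \<partial>law)"
      using affinity_pos[of \<theta>] by (simp add: V_def divide_ennreal)
    also have "\<dots> = 1"
      using affinity_pos[of \<theta>]
      by (subst nn_integral_divide) (auto simp: nn_integral_ratio_powr divide_ennreal)
    finally show "(\<integral>\<^sup>+ Z. ennreal (V \<theta> Z) \<partial>law) = 1" .
  qed
  finally have W1: "(\<integral>\<^sup>+ Z. \<integral>\<^sup>+ \<theta>. ennreal (V \<theta> Z) \<partial>\<mu> \<partial>law) = 1"
    by (simp add: prior.emeasure_space_1)
  have Wfin: "AE Z in law. (\<integral>\<^sup>+ \<theta>. ennreal (V \<theta> Z) \<partial>\<mu>) \<noteq> \<infinity>"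
    by (rule nn_integral_PInf_AE) (auto simp: W1)
  define W where "W Z = (\<integral>\<theta>. V \<theta> Z \<partial>\<mu>)" for Z
  have W_meas [measurable]: "W \<in> borel_measurable law" unfolding W_def by measurable
  have W_nn: "AE Z in law. (\<integral>\<^sup>+ \<theta>. ennreal (V \<theta> Z) \<partial>\<mu>) = ennreal (W Z) \<and> integrable \<mu> (\<lambda>\<theta>. V \<theta> Z)"
    using Wfin AE_space
  proof eventually_elim
    case (elim Z)
    have [measurable]: "Z \<in> space law" using elim by simp
    have "integrable \<mu> (\<lambda>\<theta>. V \<theta> Z)"
      using elim V0 by (intro integrableI_nonneg) (auto simp: less_top)
    then show ?case unfolding W_def using V0 by (auto intro: nn_integral_eq_integral)
  qed
  have W0: "0 \<le> W Z" for Z unfolding W_def using V0 by (intro integral_nonneg_AE) auto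
  have WN: "(\<integral>\<^sup>+ Z. ennreal (W Z) \<partial>law) = 1"
    unfolding W1[symmetric] using W_nn by (intro nn_integral_cong_AE) auto
  have W_int: "integrable law W" using WN W0 by (intro integrableI_nonneg) auto
  have W_eq: "(\<integral>Z. W Z \<partial>law) = 1" using WN W0 by (simp add: integral_eq_nn_integral)
  \<comment> \<open>\<open>G + 1\<close> bounds (1 - r) ln (g \<theta> / g s) - ln (evid / g s)
    uniformly in \<theta>. The -1 comes from \<open>ln x \<le> x - 1\<close> and is cancelled by the
    mean 1 of \<open>W\<close>.\<close>
  define G where "G Z = (1 - r) * (H Z - ln (g s Z / g b Z))
      - (ln (evid Z / g b Z) - ln (g s Z / g b Z)) - 1" for Z
  have G_int: "integrable law G"
    unfolding G_def using H_integrable integrable_ln_ratio L by simp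
  have G_eq: "(\<integral>Z. G Z \<partial>law) = (1 - r) * ((\<integral>Z. H Z \<partial>law) - kl)
      - ((\<integral>Z. ln (evid Z / g b Z) \<partial>law) - kl) - 1"
    unfolding G_def kl_def using H_integrable integrable_ln_ratio L by simp
  have bound: "AE Z in law. (\<integral>\<^sup>+ \<theta>. ennreal (g \<theta> Z * - ln (affinity r \<theta>)) \<partial>\<mu>)
      / (\<integral>\<^sup>+ \<theta>. ennreal (g \<theta> Z) \<partial>\<mu>) \<le> ennreal (G Z + W Z) \<and> 0 \<le> G Z + W Z"
    using AE_law_pos AE_ln_le_H AE_evid W_nn
  proof eventually_elim
    case (elim Z)
    have [measurable]: "Z \<in> space N" and pos: "0 < g \<theta> Z" and ev: "0 < evid Z"
      and H: "ln (g \<theta> Z / g b Z) \<le> H Z" for \<theta> using elim by auto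
    have evN: "(\<integral>\<^sup>+ \<theta>. ennreal (g \<theta> Z) \<partial>\<mu>) = ennreal (evid Z)" using elim by simp
    have g_i: "integrable \<mu> (\<lambda>\<theta>. g \<theta> Z)" by (intro integrableI_nonneg) (auto simp: evN)
    have g_e: "(\<integral>\<theta>. g \<theta> Z \<partial>\<mu>) = evid Z"
      using ev by (simp add: integral_eq_nn_integral evN)
    have pt: "g \<theta> Z * - ln (affinity r \<theta>) / evid Z \<le> G Z * (g \<theta> Z / evid Z) + V \<theta> Z" for \<theta>
    proof -
      define c where "c = (1 - r) * ln (g \<theta> Z / g s Z) - ln (evid Z / g s Z)"
      \<comment> \<open>Here \<open>g \<theta> Z / evid Z\<close> is the posterior density relative
        to the prior, so the argument is the weight \<open>V\<close> divided by that density, and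
        its posterior mean is \<open>W Z\<close>.\<close>
      have "ln (V \<theta> Z * (evid Z / g \<theta> Z)) \<le> V \<theta> Z * (evid Z / g \<theta> Z) - 1"
        using pos affinity_pos[of \<theta>] ev by (intro ln_le_minus_one) (auto simp: V_def less_le)
      moreover have "ln (V \<theta> Z * (evid Z / g \<theta> Z)) = - ln (affinity r \<theta>) - c"
        using pos[of \<theta>] pos[of s] affinity_pos[of \<theta>] ev
        by (simp add: V_def c_def ln_mult ln_div ln_powr algebra_simps)
      moreover have "c \<le> G Z + 1"
      proof -
        have "(1 - r) * ln (g \<theta> Z / g s Z) \<le> (1 - r) * (H Z - ln (g s Z / g b Z))"
          using H[of \<theta>] pos[of \<theta>] pos[of s] pos[of b] r
          by (intro mult_left_mono) (auto simp: ln_div)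
        moreover have "ln (evid Z / g s Z) = ln (evid Z / g b Z) - ln (g s Z / g b Z)"
          using ev pos[of s] pos[of b] by (simp add: ln_div)
        ultimately show ?thesis by (simp add: c_def G_def)
      qed
      ultimately have "- ln (affinity r \<theta>) \<le> G Z + V \<theta> Z * (evid Z / g \<theta> Z)" by simp
      then have "(g \<theta> Z / evid Z) * - ln (affinity r \<theta>)
          \<le> (g \<theta> Z / evid Z) * (G Z + V \<theta> Z * (evid Z / g \<theta> Z))"
        using ev by (intro mult_left_mono) auto
      also have "\<dots> = G Z * (g \<theta> Z / evid Z) + V \<theta> Z"
        using ev pos[of \<theta>] by (simp add: field_simps)
      finally show ?thesis by simp
    qed
    \<comment> \<open>\<open>G\<close> may be negative. The upper bound in \<open>pt\<close>
      inherits its sign from the left-hand side, so passing to \<open>ennreal\<close> truncates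
      nothing.\<close>
    have lhs0: "0 \<le> g \<theta> Z * - ln (affinity r \<theta>) / evid Z" for \<theta>
      using ev affinity_le_1[of \<theta>] affinity_pos[of \<theta>]
      by (intro divide_nonneg_pos mult_nonneg_nonneg) auto
    have V_i: "integrable \<mu> (\<lambda>\<theta>. V \<theta> Z)" using elim by simp
    have e: "(\<integral>\<theta>. G Z * (g \<theta> Z / evid Z) + V \<theta> Z \<partial>\<mu>) = G Z + W Z"
      using g_i V_i ev by (simp add: W_def g_e)
    have "(\<integral>\<^sup>+ \<theta>. ennreal (g \<theta> Z * - ln (affinity r \<theta>)) \<partial>\<mu>) / (\<integral>\<^sup>+ \<theta>. ennreal (g \<theta> Z) \<partial>\<mu>)
        = (\<integral>\<^sup>+ \<theta>. ennreal (g \<theta> Z * - ln (affinity r \<theta>)) / ennreal (evid Z) \<partial>\<mu>)"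
      unfolding evN by (rule nn_integral_divide[symmetric]) measurable
    also have "\<dots> \<le> (\<integral>\<^sup>+ \<theta>. ennreal (G Z * (g \<theta> Z / evid Z) + V \<theta> Z) \<partial>\<mu>)"
    proof (rule nn_integral_mono)
      fix \<theta>
      have "0 \<le> g \<theta> Z * - ln (affinity r \<theta>)"
        using affinity_le_1[of \<theta>] affinity_pos[of \<theta>] by (intro mult_nonneg_nonneg) auto
      then show "ennreal (g \<theta> Z * - ln (affinity r \<theta>)) / ennreal (evid Z)
          \<le> ennreal (G Z * (g \<theta> Z / evid Z) + V \<theta> Z)"
        using pt[of \<theta>] ev by (simp only: divide_ennreal ennreal_leI)
    qed
    also have "\<dots> = ennreal (\<integral>\<theta>. G Z * (g \<theta> Z / evid Z) + V \<theta> Z \<partial>\<mu>)"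
      using g_i V_i order_trans[OF lhs0 pt] by (intro nn_integral_eq_integral) auto
    finally show ?case
      unfolding e[symmetric] using order_trans[OF lhs0 pt] by (auto intro!: integral_nonneg_AE)
  qed
  have "(\<integral>\<^sup>+ Z. (\<integral>\<^sup>+ \<theta>. ennreal (g \<theta> Z * - ln (affinity r \<theta>)) \<partial>\<mu>)
             / (\<integral>\<^sup>+ \<theta>. ennreal (g \<theta> Z) \<partial>\<mu>) \<partial>law) \<le> (\<integral>\<^sup>+ Z. ennreal (G Z + W Z) \<partial>law)"
    using bound by (intro nn_integral_mono_AE) auto
  also have "\<dots> = ennreal (\<integral>Z. G Z + W Z \<partial>law)"
    using bound G_int W_int by (intro nn_integral_eq_integral) auto
  also have "(\<integral>Z. G Z + W Z \<partial>law)
      = (1 - r) * ((\<integral>Z. H Z \<partial>law) - kl) + kl - (\<integral>Z. ln (evid Z / g b Z) \<partial>law)"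
    using G_int W_int by (simp add: G_eq W_eq)
  finally show ?thesis .
qed

lemma ln_nn_integral_exp_llr_le:
  assumes "0 < (\<integral>\<^sup>+ \<theta>. ennreal (exp_llr \<theta>) \<partial>\<mu>)"
  shows "ln (enn2real (\<integral>\<^sup>+ \<theta>. ennreal (exp_llr \<theta>) \<partial>\<mu>)) \<le> kl"
proof -
  have "(\<integral>\<^sup>+ \<theta>. ennreal (exp_llr \<theta>) \<partial>\<mu>) < \<top>"
    using nn_integral_exp_llr_le by (rule le_less_trans) simp
  then have pos: "0 < enn2real (\<integral>\<^sup>+ \<theta>. ennreal (exp_llr \<theta>) \<partial>\<mu>)"
    using assms by (simp add: enn2real_positive_iff)
  have "enn2real (\<integral>\<^sup>+ \<theta>. ennreal (exp_llr \<theta>) \<partial>\<mu>) \<le> exp kl"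
    using enn2real_mono[OF nn_integral_exp_llr_le] by simp
  then show ?thesis using pos by (metis ln_exp ln_le_cancel_iff exp_gt_zero)
qed

lemma posterior_renyi_bound:
  assumes K: "0 < (\<integral>\<^sup>+ \<theta>. ennreal (exp_llr \<theta>) \<partial>\<mu>)"
    and C: "(\<integral>Z. H Z \<partial>law) - kl \<le> C" and c: "0 \<le> c"
  shows "(\<integral>\<^sup>+ Z. (\<integral>\<^sup>+ \<theta>. ennreal (g \<theta> Z) * ennreal (c * - ln (affinity r \<theta>)) \<partial>\<mu>)
             / (\<integral>\<^sup>+ \<theta>. ennreal (g \<theta> Z) \<partial>\<mu>) \<partial>law)
      \<le> ennreal (c * ((1 - r) * C + (1 + r) * (kl - ln (enn2real (\<integral>\<^sup>+ \<theta>. ennreal (exp_llr \<theta>) \<partial>\<mu>)))))"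
proof -
  define \<kappa> where "\<kappa> = enn2real (\<integral>\<^sup>+ \<theta>. ennreal (exp_llr \<theta>) \<partial>\<mu>)"
  have le: "ln \<kappa> \<le> kl" unfolding \<kappa>_def by (rule ln_nn_integral_exp_llr_le[OF K])
  have "(\<integral>\<^sup>+ Z. (\<integral>\<^sup>+ \<theta>. ennreal (g \<theta> Z) * ennreal (c * - ln (affinity r \<theta>)) \<partial>\<mu>)
             / (\<integral>\<^sup>+ \<theta>. ennreal (g \<theta> Z) \<partial>\<mu>) \<partial>law)
      = (\<integral>\<^sup>+ Z. ennreal c * ((\<integral>\<^sup>+ \<theta>. ennreal (g \<theta> Z * - ln (affinity r \<theta>)) \<partial>\<mu>)
             / (\<integral>\<^sup>+ \<theta>. ennreal (g \<theta> Z) \<partial>\<mu>)) \<partial>law)"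
  proof (rule nn_integral_cong)
    fix Z assume "Z \<in> space law"
    then have [measurable]: "Z \<in> space N" by simp
    have "ennreal (g \<theta> Z) * ennreal (c * - ln (affinity r \<theta>))
        = ennreal c * ennreal (g \<theta> Z * - ln (affinity r \<theta>))" for \<theta>
    proof -
      have "0 \<le> - ln (affinity r \<theta>)" using affinity_le_1[of \<theta>] affinity_pos[of \<theta>] by simp
      then have "ennreal (g \<theta> Z) * ennreal (c * - ln (affinity r \<theta>))
          = ennreal (g \<theta> Z * (c * - ln (affinity r \<theta>)))"
        and "ennreal c * ennreal (g \<theta> Z * - ln (affinity r \<theta>))
          = ennreal (c * (g \<theta> Z * - ln (affinity r \<theta>)))"
        using c by (auto simp only: ennreal_mult mult_nonneg_nonneg g_nonneg)
      then show ?thesis by (simp add: ac_simps)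
    qed
    then show "(\<integral>\<^sup>+ \<theta>. ennreal (g \<theta> Z) * ennreal (c * - ln (affinity r \<theta>)) \<partial>\<mu>)
             / (\<integral>\<^sup>+ \<theta>. ennreal (g \<theta> Z) \<partial>\<mu>)
      = ennreal c * ((\<integral>\<^sup>+ \<theta>. ennreal (g \<theta> Z * - ln (affinity r \<theta>)) \<partial>\<mu>)
             / (\<integral>\<^sup>+ \<theta>. ennreal (g \<theta> Z) \<partial>\<mu>))"
      by (simp only: nn_integral_cmult[of _ \<mu>] ennreal_times_divide) (subst nn_integral_cmult; measurable)
  qed
  also have "\<dots> = ennreal c * (\<integral>\<^sup>+ Z. (\<integral>\<^sup>+ \<theta>. ennreal (g \<theta> Z * - ln (affinity r \<theta>)) \<partial>\<mu>)
             / (\<integral>\<^sup>+ \<theta>. ennreal (g \<theta> Z) \<partial>\<mu>) \<partial>law)"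
    by (rule nn_integral_cmult) measurable
  also have "\<dots> \<le> ennreal c * ennreal ((1 - r) * ((\<integral>Z. H Z \<partial>law) - kl) + kl
      - (\<integral>Z. ln (evid Z / g b Z) \<partial>law))"
    by (intro mult_left_mono posterior_renyi_le integrable_ln_evid K) simp
  also have "\<dots> \<le> ennreal c * ennreal ((1 - r) * C + (1 + r) * (kl - ln \<kappa>))"
  proof (intro mult_left_mono ennreal_leI)
    have "(1 - r) * ((\<integral>Z. H Z \<partial>law) - kl) \<le> (1 - r) * C"
      using C r by (intro mult_left_mono) auto
    moreover have "0 \<le> r * (kl - ln \<kappa>)" using le r by simp
    moreover have "ln \<kappa> \<le> (\<integral>Z. ln (evid Z / g b Z) \<partial>law)"
      unfolding \<kappa>_def by (rule ln_le_integral_ln_evid[OF K])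
    ultimately show "(1 - r) * ((\<integral>Z. H Z \<partial>law) - kl) + kl - (\<integral>Z. ln (evid Z / g b Z) \<partial>law)
        \<le> (1 - r) * C + (1 + r) * (kl - ln \<kappa>)" by (simp add: algebra_simps)
  qed simp
  also have "\<dots> = ennreal (c * ((1 - r) * C + (1 + r) * (kl - ln \<kappa>)))"
    using c by (simp add: ennreal_mult')
  finally show ?thesis by (simp add: \<kappa>_def)
qed

end

end

subsection \<open>Nets and polynomial bounds\<close>

text \<open>Regularity applies only inside \<Theta>, so net points must lie in \<open>S\<close>: one
  representative is picked from each occupied cell of a grid. Mesh \<epsilon> / DIM makes the l1
  diameter of a cell at most \<epsilon>; the 3 absorbs the rounding of the cell indices.\<close>

lemma exists_finite_net:
  fixes S :: "'a::euclidean_space set" and R \<epsilon> :: real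
  assumes S: "S \<subseteq> cball 0 R" "S \<noteq> {}" and \<epsilon>: "0 < \<epsilon>" and R: "0 < R"
  obtains F where "finite F" "F \<noteq> {}" "F \<subseteq> S" "\<And>x. x \<in> S \<Longrightarrow> \<exists>y\<in>F. norm (x - y) \<le> \<epsilon>"
    "real (card F) \<le> (2 * R * DIM('a) / \<epsilon> + 3) ^ DIM('a)"
proof -
  define \<delta> where "\<delta> = \<epsilon> / DIM('a)"
  have \<delta>: "0 < \<delta>" using \<epsilon> by (simp add: \<delta>_def)
  define I where "I = {\<lfloor>- R / \<delta>\<rfloor>..\<lfloor>R / \<delta>\<rfloor>}"
  define \<phi> :: "'a \<Rightarrow> 'a \<Rightarrow> int" where "\<phi> x = (\<lambda>u\<in>Basis. \<lfloor>(x \<bullet> u) / \<delta>\<rfloor>)" for x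
  have \<phi>_in: "\<phi> ` S \<subseteq> PiE Basis (\<lambda>_. I)"
  proof (rule image_subsetI)
    fix x assume "x \<in> S"
    then have x: "norm x \<le> R" using S by auto
    have "\<lfloor>(x \<bullet> u) / \<delta>\<rfloor> \<in> I" if "u \<in> Basis" for u
    proof -
      have "\<bar>x \<bullet> u\<bar> \<le> R" using Basis_le_norm[OF that, of x] x by simp
      then have "- R / \<delta> \<le> (x \<bullet> u) / \<delta>" "(x \<bullet> u) / \<delta> \<le> R / \<delta>"
        using \<delta> divide_right_mono[of "- R" "x \<bullet> u" \<delta>] divide_right_mono[of "x \<bullet> u" R \<delta>] by auto
      then show ?thesis unfolding I_def by (auto intro: floor_mono)
    qed
    then show "\<phi> x \<in> PiE Basis (\<lambda>_. I)" by (auto simp: \<phi>_def)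
  qed
  have fin: "finite (PiE (Basis :: 'a set) (\<lambda>_. I))" by (intro finite_PiE) (auto simp: I_def)
  define F where "F = (\<lambda>c. SOME x. x \<in> S \<and> \<phi> x = c) ` (\<phi> ` S)"
  have pick: "(SOME y. y \<in> S \<and> \<phi> y = \<phi> x) \<in> S \<and> \<phi> (SOME y. y \<in> S \<and> \<phi> y = \<phi> x) = \<phi> x"
    if "x \<in> S" for x
    by (rule someI[of "\<lambda>y. y \<in> S \<and> \<phi> y = \<phi> x" x]) (use that in auto)
  show thesis
  proof
    show "finite F" unfolding F_def using finite_subset[OF \<phi>_in fin] by auto
    show "F \<noteq> {}" using S by (auto simp: F_def)
    show "F \<subseteq> S" using pick by (auto simp: F_def)
    show "\<exists>y\<in>F. norm (x - y) \<le> \<epsilon>" if x: "x \<in> S" for x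
    proof
      define y where "y = (SOME y. y \<in> S \<and> \<phi> y = \<phi> x)"
      show "y \<in> F" using x by (auto simp: F_def y_def)
      have eq: "\<phi> y = \<phi> x" using pick[OF x] by (simp add: y_def)
      have "\<bar>(x - y) \<bullet> u\<bar> \<le> \<delta>" if u: "u \<in> Basis" for u
      proof -
        have "\<lfloor>(y \<bullet> u) / \<delta>\<rfloor> = \<lfloor>(x \<bullet> u) / \<delta>\<rfloor>"
          using fun_cong[OF eq, of u] u by (simp add: \<phi>_def)
        then have "\<bar>(x \<bullet> u) / \<delta> - (y \<bullet> u) / \<delta>\<bar> \<le> 1" by linarith
        then have "\<bar>((x - y) \<bullet> u) / \<delta>\<bar> \<le> 1" by (simp add: inner_diff_left diff_divide_distrib)
        then show ?thesis using \<delta> by (simp add: abs_divide pos_divide_le_eq)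
      qed
      then have "(\<Sum>u\<in>Basis. \<bar>(x - y) \<bullet> u\<bar>) \<le> real DIM('a) * \<delta>"
        by (intro order_trans[OF sum_bounded_above]) auto
      then show "norm (x - y) \<le> \<epsilon>"
        using norm_le_l1[of "x - y"] by (simp add: \<delta>_def)
    qed
    have "card F \<le> card (\<phi> ` S)"
      unfolding F_def by (intro card_image_le finite_subset[OF \<phi>_in fin])
    also have "\<dots> \<le> card (PiE (Basis :: 'a set) (\<lambda>_. I))" by (intro card_mono fin \<phi>_in)
    also have "\<dots> = card I ^ DIM('a)" by (simp add: card_PiE)
    finally have "real (card F) \<le> real (card I) ^ DIM('a)" by (metis of_nat_le_iff of_nat_power)
    also have "real (card I) \<le> 2 * R * DIM('a) / \<epsilon> + 3"
    proof -
      have "- R / \<delta> \<le> R / \<delta>" using R \<delta> by (intro divide_right_mono) auto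
      then have "\<lfloor>- R / \<delta>\<rfloor> \<le> \<lfloor>R / \<delta>\<rfloor>" by (rule floor_mono)
      then have "real (card I) = \<lfloor>R / \<delta>\<rfloor> - \<lfloor>- R / \<delta>\<rfloor> + 1" by (simp add: I_def)
      also have "\<dots> \<le> R / \<delta> - (- R / \<delta>) + 3" by linarith
      finally show ?thesis by (simp add: \<delta>_def)
    qed
    then have "real (card I) ^ DIM('a) \<le> (2 * R * DIM('a) / \<epsilon> + 3) ^ DIM('a)"
      by (intro power_mono) auto
    finally show "real (card F) \<le> (2 * R * DIM('a) / \<epsilon> + 3) ^ DIM('a)" .
  qed
qed

text \<open>A base of at least 2 lets coefficients and the doubling from sums be absorbed by raising
  the exponent, so that no separate constants have to be tracked.\<close>

lemma poly_le_power:
  fixes P :: "real poly"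
  obtains n where "\<And>x. 0 \<le> x \<Longrightarrow> \<bar>poly P x\<bar> \<le> (x + 2) ^ n"
proof -
  have "\<exists>n. \<forall>x\<ge>0. \<bar>poly P x\<bar> \<le> (x + 2) ^ n"
  proof (induction P)
    case 0
    show ?case by (auto intro!: exI[of _ 0])
  next
    case (pCons a P)
    then obtain n where n: "\<And>x. 0 \<le> x \<Longrightarrow> \<bar>poly P x\<bar> \<le> (x + 2) ^ n" by auto
    obtain m where m: "\<bar>a\<bar> < 2 ^ m"
      using real_arch_pow[of 2 "\<bar>a\<bar>"] by auto
    show ?case
    proof (intro exI allI impI)
      fix x :: real assume x: "0 \<le> x"
      let ?y = "x + 2"
      have "\<bar>poly (pCons a P) x\<bar> \<le> \<bar>a\<bar> + x * \<bar>poly P x\<bar>"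
        using x by (simp add: abs_mult order_trans[OF abs_triangle_ineq])
      moreover have "\<bar>a\<bar> \<le> ?y ^ (m + Suc n)"
        using m power_mono[of 2 ?y m] power_increasing[of m "m + Suc n" ?y] x by linarith
      moreover have "x * \<bar>poly P x\<bar> \<le> ?y * ?y ^ n" using n[OF x] x by (intro mult_mono) auto
      moreover have "?y * ?y ^ n \<le> ?y ^ (m + Suc n)"
        using power_increasing[of "Suc n" "m + Suc n" ?y] x by simp
      moreover have "2 * ?y ^ (m + Suc n) \<le> ?y * ?y ^ (m + Suc n)"
        using x by (intro mult_right_mono) auto
      ultimately show "\<bar>poly (pCons a P) x\<bar> \<le> ?y ^ Suc (m + Suc n)"
        unfolding power_Suc by linarith
    qed
  qed
  then show thesis using that by auto
qed

subsection \<open>Sequential densities\<close>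

lemma seq_dens_measurable:
  fixes p :: "nat \<Rightarrow> (nat \<Rightarrow> 'z::euclidean_space) \<Rightarrow> 'a::euclidean_space \<Rightarrow> 'z \<Rightarrow> real"
  assumes "\<Theta> \<in> sets lborel"
    and "\<And>t. (\<lambda>(\<theta>, x). indicator \<Theta> \<theta> * p t (restrict x {..<t}) \<theta> (x t))
               \<in> borel_measurable (lborel \<Otimes>\<^sub>M PiM {..<Suc t} (\<lambda>_. lborel))"
  shows "(\<lambda>(\<theta>, Z). indicator \<Theta> \<theta> * seq_dens p T \<theta> Z)
    \<in> borel_measurable (lborel \<Otimes>\<^sub>M PiM {..<T} (\<lambda>_. lborel))"
proof -
  let ?M = "lborel \<Otimes>\<^sub>M PiM {..<T} (\<lambda>_. lborel) :: ('a \<times> (nat \<Rightarrow> 'z)) measure"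
  have [measurable]: "\<Theta> \<in> sets borel" using assms(1) by simp
  have fac: "(\<lambda>x. indicator \<Theta> (fst x) * p t (restrict (snd x) {..<t}) (fst x) (snd x t))
      \<in> borel_measurable ?M" if t: "t < T" for t
  proof -
    have res: "(\<lambda>x. (fst x, restrict (snd x) {..<Suc t}))
        \<in> ?M \<rightarrow>\<^sub>M lborel \<Otimes>\<^sub>M PiM {..<Suc t} (\<lambda>_. lborel)"
      by (intro measurable_Pair measurable_fst
          measurable_compose[OF measurable_snd measurable_restrict_subset]) (use t in auto)
    have "restrict (restrict x {..<Suc t}) {..<t} = restrict x {..<t}" for x :: "nat \<Rightarrow> 'z"
      by (auto simp: restrict_def)
    then show ?thesis using measurable_compose[OF res assms(2)[of t]] by simp
  qed
  \<comment> \<open>The indicator is idempotent and can go into each factor; the outer copy stays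
    for \<open>T = 0\<close>, where the product is empty.\<close>
  have "(\<lambda>(\<theta>, Z). indicator \<Theta> \<theta> * seq_dens p T \<theta> Z)
     = (\<lambda>x. indicator \<Theta> (fst x) *
          (\<Prod>t<T. indicator \<Theta> (fst x) * p t (restrict (snd x) {..<t}) (fst x) (snd x t)))"
    by (auto simp: fun_eq_iff seq_dens_def indicator_def)
  also have "\<dots> \<in> borel_measurable ?M"
    by (intro borel_measurable_times borel_measurable_prod fac) auto
  finally show ?thesis .
qed

lemma seq_dens_Suc:
  "seq_dens p (Suc T) \<theta> (Z(T := z)) = seq_dens p T \<theta> Z * p T (restrict Z {..<T}) \<theta> z"
proof -
  have "restrict (Z(T := z)) {..<t} = restrict Z {..<t}" if "t \<le> T" for t
    using that by (auto simp: restrict_def)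
  then show ?thesis by (auto simp: seq_dens_def intro!: prod.cong)
qed

lemma nn_integral_seq_dens:
  fixes p :: "nat \<Rightarrow> (nat \<Rightarrow> 'z::euclidean_space) \<Rightarrow> 'a::euclidean_space \<Rightarrow> 'z \<Rightarrow> real"
  assumes nonneg: "\<And>t h z. 0 \<le> p t (restrict h {..<t}) \<theta> z"
    and int: "\<And>t h. (\<integral>\<^sup>+ z. ennreal (p t (restrict h {..<t}) \<theta> z) \<partial>lborel) = 1"
    and meas: "\<And>T. seq_dens p T \<theta> \<in> borel_measurable (PiM {..<T} (\<lambda>_. lborel))"
    and fac: "\<And>t h. (\<lambda>z. p t (restrict h {..<t}) \<theta> z) \<in> borel_measurable lborel"
  shows "(\<integral>\<^sup>+ Z. ennreal (seq_dens p T \<theta> Z) \<partial>PiM {..<T} (\<lambda>_. lborel)) = 1"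
proof (induction T)
  interpret product_sigma_finite "\<lambda>_ :: nat. lborel :: 'z measure" ..
  {
    case 0
    show ?case by (simp add: seq_dens_def space_PiM_empty emeasure_PiM_empty)
  next
    case (Suc T)
    have nn: "0 \<le> seq_dens p T \<theta> Z" for Z by (simp add: seq_dens_def prod_nonneg nonneg)
    have "(\<integral>\<^sup>+ Z. ennreal (seq_dens p (Suc T) \<theta> Z) \<partial>PiM {..<Suc T} (\<lambda>_. lborel))
       = (\<integral>\<^sup>+ Z. \<integral>\<^sup>+ z. ennreal (seq_dens p (Suc T) \<theta> (Z(T := z))) \<partial>lborel \<partial>PiM {..<T} (\<lambda>_. lborel))"
      unfolding lessThan_Suc
      by (rule product_nn_integral_insert) (use meas[of "Suc T"] in \<open>auto simp: lessThan_Suc\<close>)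
    also have "\<dots> = (\<integral>\<^sup>+ Z. ennreal (seq_dens p T \<theta> Z) \<partial>PiM {..<T} (\<lambda>_. lborel))"
    proof (rule nn_integral_cong)
      fix Z :: "nat \<Rightarrow> 'z"
      have "(\<integral>\<^sup>+ z. ennreal (seq_dens p (Suc T) \<theta> (Z(T := z))) \<partial>lborel)
          = (\<integral>\<^sup>+ z. ennreal (seq_dens p T \<theta> Z) * ennreal (p T (restrict Z {..<T}) \<theta> z) \<partial>lborel)"
        by (simp add: seq_dens_Suc ennreal_mult nn nonneg)
      also have "\<dots> = ennreal (seq_dens p T \<theta> Z)"
        using fac by (subst nn_integral_cmult) (auto simp: int)
      finally show "(\<integral>\<^sup>+ z. ennreal (seq_dens p (Suc T) \<theta> (Z(T := z))) \<partial>lborel)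
          = ennreal (seq_dens p T \<theta> Z)" .
    qed
    finally show ?case by (simp add: Suc)
  }
qed

text \<open>No prior appears here, so constants derived in this locale cannot depend on one unless a
  lemma introduces it.\<close>

locale seq_model =
  fixes p :: "nat \<Rightarrow> (nat \<Rightarrow> 'z::euclidean_space) \<Rightarrow> 'a::euclidean_space \<Rightarrow> 'z \<Rightarrow> real"
    and \<Theta> :: "'a set" and \<theta>s \<theta>b :: 'a and P :: "real poly"
  assumes Theta_meas: "\<Theta> \<in> sets lborel"
    and true_task: "\<theta>s \<in> \<Theta>" and ref_task: "\<theta>b \<in> \<Theta>"
    and dens_nonneg: "\<And>t h \<theta> z. \<theta> \<in> \<Theta> \<Longrightarrow> 0 \<le> p t (restrict h {..<t}) \<theta> z"
    and dens_int: "\<And>t h \<theta>. \<theta> \<in> \<Theta> \<Longrightarrow>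
                     (\<integral>\<^sup>+ z. ennreal (p t (restrict h {..<t}) \<theta> z) \<partial>lborel) = 1"
    and dens_meas: "\<And>t. (\<lambda>(\<theta>, x). indicator \<Theta> \<theta> * p t (restrict x {..<t}) \<theta> (x t))
                       \<in> borel_measurable (lborel \<Otimes>\<^sub>M PiM {..<Suc t} (\<lambda>_. lborel))"
    and regular: "\<forall>t::nat. \<forall>R::real. \<forall>\<theta>\<in>\<Theta>. \<forall>\<theta>'\<in>\<Theta>. \<forall>h z.
          0 < R \<longrightarrow> norm \<theta> \<le> R \<longrightarrow> norm \<theta>' \<le> R \<longrightarrow> (\<forall>s<t. norm (h s) \<le> R) \<longrightarrow> norm z \<le> R \<longrightarrow>
          p t (restrict h {..<t}) \<theta> z
            \<le> exp (poly P R * norm (\<theta> - \<theta>')) * p t (restrict h {..<t}) \<theta>' z"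
begin

abbreviation N :: "nat \<Rightarrow> (nat \<Rightarrow> 'z) measure" where
  "N T \<equiv> PiM {..<T} (\<lambda>_. lborel)"

text \<open>Parameters outside \<open>\<Theta>\<close> are sent to the true one, so that the family is indexed by the whole
  type.\<close>

definition dens :: "nat \<Rightarrow> 'a \<Rightarrow> (nat \<Rightarrow> 'z) \<Rightarrow> real" where
  "dens T \<theta> Z = seq_dens p T (if \<theta> \<in> \<Theta> then \<theta> else \<theta>s) Z"

lemma dens_eq: "\<theta> \<in> \<Theta> \<Longrightarrow> dens T \<theta> = seq_dens p T \<theta>"
  by (simp add: dens_def fun_eq_iff)

lemma dens_ex: "\<exists>\<theta>'\<in>\<Theta>. dens T \<theta> = seq_dens p T \<theta>'"
  using true_task by (cases "\<theta> \<in> \<Theta>") (auto simp: dens_def fun_eq_iff)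

lemma seq_dens_nonneg: "\<theta> \<in> \<Theta> \<Longrightarrow> 0 \<le> seq_dens p T \<theta> Z"
  by (simp add: seq_dens_def prod_nonneg dens_nonneg)

lemma seq_dens_le:
  assumes "\<theta> \<in> \<Theta>" "\<theta>' \<in> \<Theta>" "0 < R" "norm \<theta> \<le> R" "norm \<theta>' \<le> R" "\<forall>t<T. norm (Z t) \<le> R"
  shows "seq_dens p T \<theta> Z \<le> exp (real T * (poly P R * norm (\<theta> - \<theta>'))) * seq_dens p T \<theta>' Z"
proof -
  have "seq_dens p T \<theta> Z
      \<le> (\<Prod>t<T. exp (poly P R * norm (\<theta> - \<theta>')) * p t (restrict Z {..<t}) \<theta>' (Z t))"
    unfolding seq_dens_def using assms
    by (intro prod_mono conjI dens_nonneg regular[rule_format]) auto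
  also have "\<dots> = exp (real T * (poly P R * norm (\<theta> - \<theta>'))) * seq_dens p T \<theta>' Z"
    by (simp add: prod.distrib seq_dens_def exp_of_nat_mult)
  finally show ?thesis .
qed

text \<open>Any given sample path and pair of parameters lie in some ball, where regularity bounds
  one density by a finite multiple of the other.\<close>

lemma seq_dens_supp:
  assumes "\<theta> \<in> \<Theta>" "\<theta>' \<in> \<Theta>" "0 < seq_dens p T \<theta> Z"
  shows "0 < seq_dens p T \<theta>' Z"
proof -
  define R where "R = 1 + norm \<theta> + norm \<theta>' + (\<Sum>t<T. norm (Z t))"
  have s: "norm (Z t) \<le> (\<Sum>t<T. norm (Z t))" if "t < T" for t
    using that by (intro member_le_sum) auto
  have "norm (Z t) \<le> R" if "t < T" for t
    using s[OF that] norm_ge_zero[of \<theta>] norm_ge_zero[of \<theta>'] unfolding R_def by linarith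
  then have "\<forall>t<T. norm (Z t) \<le> R" by simp
  moreover have "0 \<le> (\<Sum>t<T. norm (Z t))" by (intro sum_nonneg) auto
  then have "0 < R" "norm \<theta> \<le> R" "norm \<theta>' \<le> R"
    using norm_ge_zero[of \<theta>] norm_ge_zero[of \<theta>'] unfolding R_def by linarith+
  ultimately have "seq_dens p T \<theta> Z \<le> exp (real T * (poly P R * norm (\<theta> - \<theta>'))) * seq_dens p T \<theta>' Z"
    by (intro seq_dens_le assms)
  then show ?thesis
    using assms seq_dens_nonneg[of \<theta>' T Z] by (cases "seq_dens p T \<theta>' Z = 0") auto
qed

lemma seq_dens_joint [measurable]:
  "(\<lambda>(\<theta>, Z). indicator \<Theta> \<theta> * seq_dens p T \<theta> Z) \<in> borel_measurable (lborel \<Otimes>\<^sub>M N T)"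
  by (rule seq_dens_measurable[OF Theta_meas dens_meas])

lemma seq_dens_borel [measurable]:
  assumes "\<theta> \<in> \<Theta>"
  shows "seq_dens p T \<theta> \<in> borel_measurable (N T)"
  using measurable_compose[OF measurable_Pair1' seq_dens_joint, of \<theta>] assms by simp

lemma dens_joint: "case_prod (dens T) \<in> borel_measurable (lborel \<Otimes>\<^sub>M N T)"
proof -
  have [measurable]: "\<Theta> \<in> sets borel" using Theta_meas by simp
  note seq_dens_borel[OF true_task, measurable]
  have "case_prod (dens T) = (\<lambda>x. (\<lambda>(\<theta>, Z). indicator \<Theta> \<theta> * seq_dens p T \<theta> Z) x
      + indicator (- \<Theta>) (fst x) * seq_dens p T \<theta>s (snd x))"
    by (auto simp: fun_eq_iff dens_def indicator_def)
  also have "\<dots> \<in> borel_measurable (lborel \<Otimes>\<^sub>M N T)" by measurable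
  finally show ?thesis .
qed

lemma step_dens_borel:
  assumes "\<theta> \<in> \<Theta>"
  shows "(\<lambda>z. p t (restrict h {..<t}) \<theta> z) \<in> borel_measurable lborel"
proof -
  have "(\<lambda>z. (restrict h {..<t})(t := z)) \<in> lborel \<rightarrow>\<^sub>M PiM (insert t {..<t}) (\<lambda>_. lborel)"
    by (rule measurable_fun_upd[where J="{..<t}"]) (auto simp: space_PiM)
  then have "(\<lambda>z. (\<theta>, (restrict h {..<t})(t := z))) \<in> lborel \<rightarrow>\<^sub>M lborel \<Otimes>\<^sub>M N (Suc t)"
    by (intro measurable_Pair) (auto simp: lessThan_Suc)
  from measurable_compose[OF this dens_meas[of t]]
  have "(\<lambda>z. indicator \<Theta> \<theta> * p t (restrict ((restrict h {..<t})(t := z)) {..<t}) \<theta> z)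
      \<in> borel_measurable lborel" by simp
  moreover have "restrict ((restrict h {..<t})(t := z)) {..<t} = restrict h {..<t}" for z
    by (auto simp: restrict_def)
  ultimately show ?thesis using assms by simp
qed

sublocale density_family "N T" "dens T" \<theta>s for T
proof -
  interpret product_sigma_finite "\<lambda>_ :: nat. lborel :: 'z measure" ..
  interpret sigma_finite_measure "N T" by (rule sigma_finite) simp
  show "density_family (N T) (dens T)"
  proof
    fix \<theta> \<theta>' Z
    obtain \<theta>1 where 1: "\<theta>1 \<in> \<Theta>" "dens T \<theta> = seq_dens p T \<theta>1" using dens_ex by blast
    obtain \<theta>2 where 2: "\<theta>2 \<in> \<Theta>" "dens T \<theta>' = seq_dens p T \<theta>2" using dens_ex by blast
    show "dens T \<theta> \<in> borel_measurable (N T)" "0 \<le> dens T \<theta> Z"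
      "(\<integral>\<^sup>+ Z. ennreal (dens T \<theta> Z) \<partial>N T) = 1"
      using 1 by (auto intro: seq_dens_nonneg nn_integral_seq_dens dens_nonneg dens_int step_dens_borel)
    show "0 < dens T \<theta> Z \<Longrightarrow> 0 < dens T \<theta>' Z" using seq_dens_supp[OF 1(1) 2(1)] 1 2 by simp
  qed
qed

lemma law_eq: "law T = seq_law p T \<theta>s"
  using true_task by (simp add: law_def seq_law_def dens_eq)

section \<open>A measurable version of the supremum of the likelihood ratios\<close>

definition net :: "'a set" where
  "net = (SOME D. countable D \<and> D \<subseteq> \<Theta> \<and> \<Theta> \<subseteq> closure D)"

lemma net: "countable net" "net \<subseteq> \<Theta>" "\<Theta> \<subseteq> closure net"
proof -
  obtain D where "countable D" "D \<subseteq> \<Theta>" "\<Theta> \<subseteq> closure D" by (rule separable[of \<Theta>]) blast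
  then have "countable D \<and> D \<subseteq> \<Theta> \<and> \<Theta> \<subseteq> closure D" by simp
  then have "countable net \<and> net \<subseteq> \<Theta> \<and> \<Theta> \<subseteq> closure net"
    unfolding net_def by (rule someI)
  then show "countable net" "net \<subseteq> \<Theta>" "\<Theta> \<subseteq> closure net" by auto
qed

text \<open>\<open>net\<close> is a countable dense subset of \<Theta>, not one of the finite
  \<epsilon>-nets: countability gives measurability, and values in \<open>ennreal\<close> make the
  supremum meaningful even where it is infinite.\<close>

definition sup_ratio :: "nat \<Rightarrow> (nat \<Rightarrow> 'z) \<Rightarrow> ennreal" where
  "sup_ratio T Z = (SUP \<theta>\<in>net. ennreal (dens T \<theta> Z / dens T \<theta>b Z))"

lemma sup_ratio_measurable [measurable]: "sup_ratio T \<in> borel_measurable (N T)"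
  unfolding sup_ratio_def by (intro borel_measurable_SUP net) measurable

text \<open>Regularity makes the densities continuous in the parameter, so the supremum over a dense
  subset already dominates all of \<Theta>.\<close>

lemma ratio_le_sup_ratio:
  assumes "\<theta> \<in> \<Theta>"
  shows "ennreal (dens T \<theta> Z / dens T \<theta>b Z) \<le> sup_ratio T Z"
proof (cases "sup_ratio T Z")
  case (real x)
  have x: "dens T \<theta>' Z / dens T \<theta>b Z \<le> x" if "\<theta>' \<in> net" for \<theta>'
  proof -
    have "ennreal (dens T \<theta>' Z / dens T \<theta>b Z) \<le> ennreal x"
      unfolding real(2)[symmetric] sup_ratio_def using that by (rule SUP_upper)
    then show ?thesis using real(1) by simp
  qed
  obtain X where X: "\<And>n. X n \<in> net" "X \<longlonglongrightarrow> \<theta>"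
    using net(3) assms by (metis closure_sequential subsetD)
  obtain B where B: "\<And>n. norm (X n) \<le> B" "0 < B"
    using convergent_imp_Bseq[OF convergentI[OF X(2)]] by (auto simp: Bseq_def)
  \<comment> \<open>One radius for the whole approximating sequence, its limit and the samples: the
    Lipschitz constant is then fixed while the distance tends to 0.\<close>
  define R where "R = B + norm \<theta> + (\<Sum>t<T. norm (Z t))"
  have s: "norm (Z t) \<le> (\<Sum>t<T. norm (Z t))" if "t < T" for t
    using that by (intro member_le_sum) auto
  have s0: "0 \<le> (\<Sum>t<T. norm (Z t))" by (intro sum_nonneg) auto
  have R1: "0 < R" "norm \<theta> \<le> R" "norm (X n) \<le> R" for n
    using B(2) s0 B(1)[of n] norm_ge_zero[of \<theta>] unfolding R_def by linarith+
  have "norm (Z t) \<le> R" if "t < T" for t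
    using s[OF that] B(2) norm_ge_zero[of \<theta>] unfolding R_def by linarith
  then have R: "0 < R" "norm \<theta> \<le> R" "norm (X n) \<le> R" "\<forall>t<T. norm (Z t) \<le> R" for n
    using R1 by auto
  have le: "dens T \<theta> Z / dens T \<theta>b Z \<le> exp (real T * (poly P R * norm (\<theta> - X n))) * x" for n
  proof -
    have "dens T \<theta> Z \<le> exp (real T * (poly P R * norm (\<theta> - X n))) * dens T (X n) Z"
      using seq_dens_le[of \<theta> "X n" R T Z] R X(1) net(2) assms by (auto simp: dens_eq subset_iff)
    then have "dens T \<theta> Z / dens T \<theta>b Z
        \<le> exp (real T * (poly P R * norm (\<theta> - X n))) * dens T (X n) Z / dens T \<theta>b Z"
      by (intro divide_right_mono) auto
    also have "\<dots> = exp (real T * (poly P R * norm (\<theta> - X n))) * (dens T (X n) Z / dens T \<theta>b Z)"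
      by simp
    also have "\<dots> \<le> exp (real T * (poly P R * norm (\<theta> - X n))) * x"
      by (intro mult_left_mono x X) auto
    finally show ?thesis .
  qed
  have "(\<lambda>n. exp (real T * (poly P R * norm (\<theta> - X n))) * x)
      \<longlonglongrightarrow> exp (real T * (poly P R * norm (\<theta> - \<theta>))) * x"
    by (intro tendsto_intros X)
  then have "dens T \<theta> Z / dens T \<theta>b Z \<le> exp (real T * (poly P R * norm (\<theta> - \<theta>))) * x"
    using le by (intro LIMSEQ_le_const) auto
  then show ?thesis using real by (simp add: ennreal_leI)
qed simp

text \<open>This is the concrete \<open>H\<close>. Where the supremum is infinite it is a mere
  default value; under the almost sure conditions of (DG)(ii), \<open>exp_env\<close> identifies it
  with the true logarithm.\<close>

definition env :: "nat \<Rightarrow> (nat \<Rightarrow> 'z) \<Rightarrow> real" where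
  "env T Z = ln (enn2real (sup_ratio T Z))"

lemma env_measurable [measurable]: "env T \<in> borel_measurable (N T)"
  unfolding env_def by measurable

lemma exp_env:
  assumes pos: "0 < seq_dens p T \<theta>b Z"
    and bdd: "bdd_above ((\<lambda>\<theta>. seq_dens p T \<theta> Z / seq_dens p T \<theta>b Z) ` \<Theta>)"
  shows "env T Z = ln (SUP \<theta>\<in>\<Theta>. seq_dens p T \<theta> Z / seq_dens p T \<theta>b Z)"
    and "exp (env T Z) = (SUP \<theta>\<in>\<Theta>. seq_dens p T \<theta> Z / seq_dens p T \<theta>b Z)"
    and "0 \<le> env T Z"
proof -
  let ?S = "SUP \<theta>\<in>\<Theta>. seq_dens p T \<theta> Z / seq_dens p T \<theta>b Z"
  have up: "seq_dens p T \<theta> Z / seq_dens p T \<theta>b Z \<le> ?S" if "\<theta> \<in> \<Theta>" for \<theta>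
    using that bdd by (rule cSUP_upper)
  have S1: "1 \<le> ?S" using up[OF ref_task] pos by simp
  have le: "sup_ratio T Z \<le> ennreal ?S"
    unfolding sup_ratio_def using net(2) ref_task
    by (intro SUP_least ennreal_leI) (auto simp: dens_eq subset_iff intro!: up)
  then have fin: "sup_ratio T Z < \<top>" by (rule le_less_trans) simp
  have "seq_dens p T \<theta> Z / seq_dens p T \<theta>b Z \<le> enn2real (sup_ratio T Z)" if "\<theta> \<in> \<Theta>" for \<theta>
    using ratio_le_sup_ratio[OF that, of T Z] fin that ref_task seq_dens_nonneg pos
    by (cases "sup_ratio T Z") (auto simp: dens_eq)
  then have "?S \<le> enn2real (sup_ratio T Z)" using ref_task by (intro cSUP_least) auto
  moreover have "enn2real (sup_ratio T Z) \<le> ?S"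
    using enn2real_mono[OF le] S1 by simp
  ultimately have eq: "enn2real (sup_ratio T Z) = ?S" by simp
  show "env T Z = ln ?S" by (simp add: env_def eq)
  then show "exp (env T Z) = ?S" "0 \<le> env T Z" using S1 by auto
qed

section \<open>The expected envelope at a fixed horizon\<close>

context
  fixes T :: nat and Q :: real
  assumes moments: "AE Z in seq_law p T \<theta>s. 0 < seq_dens p T \<theta>b Z
                \<and> bdd_above ((\<lambda>\<theta>. seq_dens p T \<theta> Z / seq_dens p T \<theta>b Z) ` \<Theta>)"
    and moment2: "(\<integral>\<^sup>+ Z. ennreal ((ln (SUP \<theta>\<in>\<Theta>. seq_dens p T \<theta> Z / seq_dens p T \<theta>b Z))\<^sup>2)
              \<partial>seq_law p T \<theta>s) \<le> ennreal Q"
begin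

lemma AE_env: "AE Z in law T. 0 \<le> env T Z \<and> 0 < seq_dens p T \<theta>b Z
  \<and> exp (env T Z) = (SUP \<theta>\<in>\<Theta>. seq_dens p T \<theta> Z / seq_dens p T \<theta>b Z)
  \<and> bdd_above ((\<lambda>\<theta>. seq_dens p T \<theta> Z / seq_dens p T \<theta>b Z) ` \<Theta>)"
  using moments unfolding law_eq
proof eventually_elim
  case (elim Z)
  then show ?case using exp_env(2,3)[of T Z] by (intro conjI) auto
qed

lemma env_moment2: "(\<integral>\<^sup>+ Z. ennreal ((env T Z)\<^sup>2) \<partial>law T) \<le> ennreal Q"
proof -
  have "(\<integral>\<^sup>+ Z. ennreal ((env T Z)\<^sup>2) \<partial>law T)
      = (\<integral>\<^sup>+ Z. ennreal ((ln (SUP \<theta>\<in>\<Theta>. seq_dens p T \<theta> Z / seq_dens p T \<theta>b Z))\<^sup>2) \<partial>law T)"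
  proof (rule nn_integral_cong_AE)
    show "AE Z in law T. ennreal ((env T Z)\<^sup>2)
        = ennreal ((ln (SUP \<theta>\<in>\<Theta>. seq_dens p T \<theta> Z / seq_dens p T \<theta>b Z))\<^sup>2)"
      using moments unfolding law_eq by eventually_elim (auto simp: exp_env)
  qed
  then show ?thesis using moment2 by (simp add: law_eq)
qed

lemma dominated: "dominated_family (N T) (dens T) \<theta>s \<theta>b (env T)"
proof
  show "env T \<in> borel_measurable (N T)" by measurable
  have "integrable (law T) (\<lambda>Z. (env T Z)\<^sup>2)"
    using le_less_trans[OF env_moment2] by (intro integrableI_nonneg) auto
  then show "integrable (law T) (env T)"
    by (rule law.square_integrable_imp_integrable[rotated]) measurable
  show "AE Z in law T. 0 \<le> env T Z" using AE_env by eventually_elim simp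
  show "AE Z in law T. \<forall>\<theta>. dens T \<theta> Z \<le> exp (env T Z) * dens T \<theta>b Z"
    using AE_env
  proof eventually_elim
    case (elim Z)
    show ?case
    proof
      fix \<theta>
      obtain \<theta>' where \<theta>': "\<theta>' \<in> \<Theta>" "dens T \<theta> = seq_dens p T \<theta>'" using dens_ex by blast
      have "seq_dens p T \<theta>' Z / seq_dens p T \<theta>b Z
          \<le> (SUP \<theta>\<in>\<Theta>. seq_dens p T \<theta> Z / seq_dens p T \<theta>b Z)"
        using elim by (intro cSUP_upper \<theta>'(1)) simp
      then have "seq_dens p T \<theta>' Z / seq_dens p T \<theta>b Z \<le> exp (env T Z)"
        using elim by simp
      then show "dens T \<theta> Z \<le> exp (env T Z) * dens T \<theta>b Z"
        using elim \<theta>' ref_task by (simp add: dens_eq pos_divide_le_eq)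
    qed
  qed
qed

text \<open>The bound \<open>c\<close> is quantified inside the almost-sure statement because it is
  later taken to be a sum of densities at \<open>Z\<close>.\<close>

lemma exp_env_le:
  "AE Z in law T. \<forall>c. (\<forall>\<theta>\<in>\<Theta>. seq_dens p T \<theta> Z \<le> c) \<longrightarrow> exp (env T Z) * dens T \<theta>b Z \<le> c"
  using AE_env
proof eventually_elim
  case (elim Z)
  show ?case
  proof safe
    fix c assume c: "\<forall>\<theta>\<in>\<Theta>. seq_dens p T \<theta> Z \<le> c"
    have "(SUP \<theta>\<in>\<Theta>. seq_dens p T \<theta> Z / seq_dens p T \<theta>b Z) \<le> c / seq_dens p T \<theta>b Z"
      using ref_task c elim by (intro cSUP_least divide_right_mono) auto
    then have "exp (env T Z) \<le> c / seq_dens p T \<theta>b Z" using elim by simp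
    then show "exp (env T Z) * dens T \<theta>b Z \<le> c"
      using elim ref_task by (simp add: dens_eq pos_le_divide_eq)
  qed
qed

text \<open>Off the two tail events, parameters in the ball are compared with a net point by
  regularity, and parameters outside it with \<theta>b, which lies in the ball. Two tails of 1 /
  (2Q) add up to the 1 / Q that balances the second moment.\<close>

lemma expected_env_le:
  fixes R :: real
  assumes Q: "0 < Q" and R: "0 < R" "norm \<theta>b \<le> R"
    and tail1: "prob_le (seq_law p T \<theta>s)
            {Z. ennreal (seq_dens p T \<theta>b Z) \<le> (SUP \<theta>\<in>{\<theta>\<in>\<Theta>. R \<le> norm \<theta>}. ennreal (seq_dens p T \<theta> Z))}
            (1 / (2 * Q))"
    and tail2: "prob_le (seq_law p T \<theta>s) {Z. \<exists>t<T. R \<le> norm (Z t)} (1 / (2 * Q))"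
  shows "(\<integral>Z. env T Z \<partial>law T) - (\<integral>Z. ln (dens T \<theta>s Z / dens T \<theta>b Z) \<partial>law T)
    \<le> DIM('a) * ln (2 * R * DIM('a) * (real T * \<bar>poly P R\<bar> + 1) + 3) + 3"
proof -
  interpret D: dominated_family "N T" "dens T" \<theta>s \<theta>b "env T" by (rule dominated)
  \<comment> \<open>Regularity costs \<open>poly P R\<close> times the distance at each of
    \<open>T\<close> steps; at this spacing, moving to the nearest net point costs at most a factor
    \<open>exp 1\<close>.\<close>
  define \<epsilon> where "\<epsilon> = 1 / (real T * \<bar>poly P R\<bar> + 1)"
  have \<epsilon>: "0 < \<epsilon>" unfolding \<epsilon>_def by (intro divide_pos_pos add_nonneg_pos mult_nonneg_nonneg) auto
  have T\<epsilon>: "real T * (poly P R * \<epsilon>) \<le> 1"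
  proof -
    have "real T * poly P R \<le> real T * \<bar>poly P R\<bar>" by (intro mult_left_mono) auto
    moreover have "0 < real T * \<bar>poly P R\<bar> + 1" by (intro add_nonneg_pos) auto
    ultimately show ?thesis unfolding \<epsilon>_def by (simp add: pos_divide_le_eq)
  qed
  have "\<theta>b \<in> \<Theta> \<inter> cball 0 R" using ref_task R by simp
  then have ne: "\<Theta> \<inter> cball 0 R \<noteq> {}" by blast
  obtain F where F: "finite F" "F \<noteq> {}" "F \<subseteq> \<Theta> \<inter> cball 0 R"
      "\<And>x. x \<in> \<Theta> \<inter> cball 0 R \<Longrightarrow> \<exists>y\<in>F. norm (x - y) \<le> \<epsilon>"
      "real (card F) \<le> (2 * R * DIM('a) / \<epsilon> + 3) ^ DIM('a)"
    using exists_finite_net[OF Int_lower2 ne \<epsilon> R(1)] by metis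
  obtain A1 where A1 [measurable]: "A1 \<in> sets (N T)" and A1': "measure (law T) A1 \<le> 1 / (2 * Q)"
    and E1: "{Z. ennreal (seq_dens p T \<theta>b Z) \<le> (SUP \<theta>\<in>{\<theta>\<in>\<Theta>. R \<le> norm \<theta>}. ennreal (seq_dens p T \<theta> Z))}
        \<inter> space (N T) \<subseteq> A1"
    using tail1 by (auto simp: prob_le_def simp flip: law_eq)
  obtain A2 where A2 [measurable]: "A2 \<in> sets (N T)" and A2': "measure (law T) A2 \<le> 1 / (2 * Q)"
    and E2: "{Z. \<exists>t<T. R \<le> norm (Z t)} \<inter> space (N T) \<subseteq> A2"
    using tail2 by (auto simp: prob_le_def simp flip: law_eq)
  have "measure (law T) (A1 \<union> A2) \<le> measure (law T) A1 + measure (law T) A2"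
    by (intro measure_Un_le) auto
  then have PA: "measure (law T) (A1 \<union> A2) \<le> 1 / Q" using A1' A2' by simp
  have "(\<integral>Z. env T Z \<partial>law T) - D.kl \<le> ln (real (card F)) + 3"
  proof (rule D.expected_sup_log_ratio_le[OF F(1,2) _ Q PA env_moment2])
    show "AE Z in law T. Z \<notin> A1 \<union> A2 \<longrightarrow> exp (env T Z) * dens T \<theta>b Z \<le> exp 1 * (\<Sum>i\<in>F. dens T i Z)"
      using exp_env_le AE_space
    proof eventually_elim
      case (elim Z)
      show ?case
      proof (intro impI elim(1)[rule_format] ballI)
        fix \<theta> assume Z: "Z \<notin> A1 \<union> A2" and \<theta>: "\<theta> \<in> \<Theta>"
        have Zsp: "Z \<in> space (N T)" using elim by simp
        have "Z \<notin> {Z. \<exists>t<T. R \<le> norm (Z t)}" using E2 Z Zsp by blast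
        then have ZR: "\<forall>t<T. norm (Z t) \<le> R" by force
        have ball: "seq_dens p T \<theta> Z \<le> exp 1 * (\<Sum>i\<in>F. dens T i Z)"
          if \<theta>: "\<theta> \<in> \<Theta>" "norm \<theta> \<le> R" for \<theta>
        proof -
          obtain y where y: "y \<in> F" "norm (\<theta> - y) \<le> \<epsilon>" using F(4)[of \<theta>] \<theta> by auto
          have y': "y \<in> \<Theta>" "norm y \<le> R" using y F(3) by auto
          have "seq_dens p T \<theta> Z \<le> exp (real T * (poly P R * norm (\<theta> - y))) * seq_dens p T y Z"
            by (intro seq_dens_le \<theta> y' R ZR)
          also have "\<dots> \<le> exp 1 * seq_dens p T y Z"
          proof (intro mult_right_mono seq_dens_nonneg y')
            have "real T * (poly P R * norm (\<theta> - y)) \<le> 1"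
            proof (cases "0 \<le> poly P R")
              case True
              then have "real T * (poly P R * norm (\<theta> - y)) \<le> real T * (poly P R * \<epsilon>)"
                using y by (intro mult_left_mono) auto
              then show ?thesis using T\<epsilon> by simp
            next
              case False
              then have "real T * (poly P R * norm (\<theta> - y)) \<le> 0"
                by (intro mult_nonneg_nonpos mult_nonpos_nonneg) auto
              then show ?thesis by simp
            qed
            then show "exp (real T * (poly P R * norm (\<theta> - y))) \<le> exp 1" by simp
          qed
          also have "seq_dens p T y Z \<le> (\<Sum>i\<in>F. dens T i Z)"
            using member_le_sum[OF y(1), of "\<lambda>i. dens T i Z"] F(1) y' by (simp add: dens_eq)
          finally show ?thesis by simp
        qed
        show "seq_dens p T \<theta> Z \<le> exp 1 * (\<Sum>i\<in>F. dens T i Z)"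
        proof (cases "norm \<theta> \<le> R")
          case True
          then show ?thesis using ball \<theta> by blast
        next
          case False
          have "ennreal (seq_dens p T \<theta> Z) \<le> (SUP \<theta>\<in>{\<theta>\<in>\<Theta>. R \<le> norm \<theta>}. ennreal (seq_dens p T \<theta> Z))"
            using \<theta> False by (intro SUP_upper) auto
          also have "\<dots> \<le> ennreal (seq_dens p T \<theta>b Z)"
          proof -
            have "Z \<notin> {Z. ennreal (seq_dens p T \<theta>b Z)
                \<le> (SUP \<theta>\<in>{\<theta>\<in>\<Theta>. R \<le> norm \<theta>}. ennreal (seq_dens p T \<theta> Z))}"
              using E1 Z Zsp by blast
            then show ?thesis by (simp only: mem_Collect_eq not_le less_imp_le)
          qed
          finally have "seq_dens p T \<theta> Z \<le> seq_dens p T \<theta>b Z"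
            using seq_dens_nonneg[OF ref_task, of T Z] by simp
          also have "\<dots> \<le> exp 1 * (\<Sum>i\<in>F. dens T i Z)" using ball ref_task R by blast
          finally show ?thesis .
        qed
      qed
    qed
  qed measurable
  also have "ln (real (card F)) \<le> ln ((2 * R * DIM('a) / \<epsilon> + 3) ^ DIM('a))"
    using F(1,2,5) by (subst ln_le_cancel_iff) (auto simp: card_gt_0_iff intro: less_le_trans[OF _ F(5)])
  also have "\<dots> = DIM('a) * ln (2 * R * DIM('a) * (real T * \<bar>poly P R\<bar> + 1) + 3)"
    by (subst ln_realpow) (use R in \<open>auto simp: \<epsilon>_def intro!: add_nonneg_pos mult_nonneg_nonneg\<close>)
  finally show ?thesis by (simp add: D.kl_def)
qed

end

end

section \<open>Logarithmic growth of the remainder in the horizon\<close>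

lemma prob_le_mono: "prob_le M E x \<Longrightarrow> x \<le> y \<Longrightarrow> prob_le M E y"
  by (auto simp: prob_le_def intro: order_trans)

context seq_model
begin

text \<open>With \<open>y = T + a\<close> every polynomial in \<open>T\<close> is below a power of \<open>y\<close>, so the radius
  \<open>y ^ m\<close> kills the tails while the logarithm of the net size stays \<open>O(ln y)\<close>.\<close>

lemma expected_env_le_ln:
  fixes k :: real and P1 P2 :: "real poly"
  assumes k: "1 \<le> k"
    and tails: "\<And>T R. 1 \<le> T \<Longrightarrow> real T \<le> R \<Longrightarrow>
          prob_le (seq_law p T \<theta>s)
            {Z. ennreal (seq_dens p T \<theta>b Z) \<le> (SUP \<theta>\<in>{\<theta>\<in>\<Theta>. R \<le> norm \<theta>}. ennreal (seq_dens p T \<theta> Z))}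
            (poly P1 (real T) / (1 + R powr (1 / k)))
        \<and> prob_le (seq_law p T \<theta>s) {Z. \<exists>t<T. R \<le> norm (Z t)}
            (poly P1 (real T) / (1 + R powr (1 / k)))"
    and moments: "\<And>T. 1 \<le> T \<Longrightarrow> AE Z in seq_law p T \<theta>s. 0 < seq_dens p T \<theta>b Z
                \<and> bdd_above ((\<lambda>\<theta>. seq_dens p T \<theta> Z / seq_dens p T \<theta>b Z) ` \<Theta>)"
    and moment2: "\<And>T. 1 \<le> T \<Longrightarrow>
        (\<integral>\<^sup>+ Z. ennreal ((ln (SUP \<theta>\<in>\<Theta>. seq_dens p T \<theta> Z / seq_dens p T \<theta>b Z))\<^sup>2)
              \<partial>seq_law p T \<theta>s) \<le> ennreal (poly P2 (real T))"
  obtains C where "0 \<le> C" "\<And>T. 1 \<le> T \<Longrightarrow>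
    (\<integral>Z. env T Z \<partial>law T) - (\<integral>Z. ln (dens T \<theta>s Z / dens T \<theta>b Z) \<partial>law T) \<le> C * ln (real T + 1)"
proof -
  obtain n1 where n1: "\<And>x. 0 \<le> x \<Longrightarrow> \<bar>poly P1 x\<bar> \<le> (x + 2) ^ n1" using poly_le_power[of P1] by blast
  obtain n2 where n2: "\<And>x. 0 \<le> x \<Longrightarrow> \<bar>poly P2 x\<bar> \<le> (x + 2) ^ n2" using poly_le_power[of P2] by blast
  obtain n3 where n3: "\<And>x. 0 \<le> x \<Longrightarrow> \<bar>poly P x\<bar> \<le> (x + 2) ^ n3" using poly_le_power[of P] by blast
  obtain K :: nat where K: "k \<le> real K" using real_arch_simple by blast
  define d where "d = real DIM('a)"
  define a where "a = 2 + norm \<theta>b + d"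
  \<comment> \<open>The tail must supply \<open>n1\<close> for its numerator, \<open>n2\<close> for
    \<open>Q\<close> and one more power of \<open>y\<close> for the factor 2. Multiplying by
    \<open>K \<ge> k\<close> in \<open>m\<close> undoes the root \<open>1 / k\<close>.\<close>
  define e where "e = n1 + n2 + 1"
  define m where "m = K * e"
  \<comment> \<open>Powers of \<open>R\<close> that bound \<open>X\<close>: three for
    \<open>2 * R * d\<close>, \<open>2 * n3\<close> for the polynomial, two for the factor
    \<open>T\<close> and the added 1, and one for the final 3.\<close>
  define j where "j = 2 * n3 + 6"
  \<comment> \<open>The factor \<open>1 + ln a / ln 2\<close> turns ln (T + a) into ln (T + 1), and
    \<open>3 / ln 2\<close> absorbs the additive 3; both use ln (T + 1) \<ge> ln 2. With ln T
    instead, the bound would be 0 at T = 1.\<close>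
  define C where "C = d * (real j * real m) * (1 + ln a / ln 2) + 3 / ln 2"
  have d1: "1 \<le> d" by (simp add: d_def Suc_le_eq)
  have a: "3 \<le> a" "norm \<theta>b \<le> a" "d \<le> a" using d1 norm_ge_zero[of \<theta>b] unfolding a_def by linarith+
  have "1 \<le> real K" using k K by simp
  then have m1: "1 \<le> m" by (simp add: m_def e_def Suc_le_eq)
  have C0: "0 \<le> C" unfolding C_def using d1 a by auto
  show thesis
  proof (rule that[OF C0])
    fix T :: nat assume T: "1 \<le> T"
    define y where "y = real T + a"
    have y: "4 \<le> y" "real T \<le> y" "norm \<theta>b \<le> y" "d \<le> y" "real T + 2 \<le> y"
      using T a by (auto simp: y_def)
    define R where "R = y ^ m"
    have yR: "y \<le> R" unfolding R_def using m1 y by (simp add: self_le_power)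
    have R: "4 \<le> R" "real T \<le> R" "norm \<theta>b \<le> R" "d \<le> R" using y yR by auto
    have powr: "y ^ e \<le> R powr (1 / k)"
    proof -
      have "y ^ e = y powr real e" using y by (simp add: powr_realpow)
      also have "\<dots> \<le> y powr (real m * (1 / k))"
      proof (rule powr_mono)
        have "real e * k \<le> real e * real K" using K by (intro mult_left_mono) auto
        then show "real e \<le> real m * (1 / k)" using k by (simp add: m_def field_simps)
      qed (use y in auto)
      also have "\<dots> = R powr (1 / k)" using y by (simp add: R_def powr_powr flip: powr_realpow)
      finally show ?thesis .
    qed
    define Q where "Q = y ^ n2"
    have Q: "0 < Q" using y by (simp add: Q_def)
    have "poly P2 (real T) \<le> (real T + 2) ^ n2" using n2[of "real T"] by simp
    also have "\<dots> \<le> Q" unfolding Q_def using y by (intro power_mono) auto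
    finally have PQ: "poly P2 (real T) \<le> Q" .
    have tail: "poly P1 (real T) / (1 + R powr (1 / k)) \<le> 1 / (2 * Q)"
    proof -
      have "poly P1 (real T) \<le> (real T + 2) ^ n1" using n1[of "real T"] by simp
      also have "\<dots> \<le> y ^ n1" using y by (intro power_mono) auto
      finally have "poly P1 (real T) * (2 * Q) \<le> y ^ n1 * (y * Q)"
        using y Q by (intro mult_mono mult_right_mono) auto
      also have "\<dots> = y ^ e" by (simp add: e_def Q_def power_add)
      also have "\<dots> \<le> 1 + R powr (1 / k)" using powr by simp
      moreover have "0 < 1 + R powr (1 / k)" by (intro add_pos_nonneg) auto
      ultimately show ?thesis using Q by (simp add: field_simps)
    qed
    have m2: "(\<integral>\<^sup>+ Z. ennreal ((ln (SUP \<theta>\<in>\<Theta>. seq_dens p T \<theta> Z / seq_dens p T \<theta>b Z))\<^sup>2)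
              \<partial>seq_law p T \<theta>s) \<le> ennreal Q"
      using moment2[OF T] ennreal_leI[OF PQ] by (rule order_trans)
    define X where "X = 2 * R * d * (real T * \<bar>poly P R\<bar> + 1) + 3"
    have "(\<integral>Z. env T Z \<partial>law T) - (\<integral>Z. ln (dens T \<theta>s Z / dens T \<theta>b Z) \<partial>law T) \<le> d * ln X + 3"
      unfolding X_def d_def using R tails[OF T, of R] tail
      by (intro expected_env_le[OF moments[OF T] m2 Q]) (auto intro: prob_le_mono)
    also have "ln X \<le> ln (R ^ j)"
    proof (subst ln_le_cancel_iff)
      show "0 < X" unfolding X_def using R d1 by (intro add_nonneg_pos mult_nonneg_nonneg) auto
      show "0 < R ^ j" using R by simp
      define q where "q = R ^ (2 * n3)"
      have q: "1 \<le> q" using R by (simp add: q_def)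
      have "\<bar>poly P R\<bar> \<le> (R + 2) ^ n3" using n3 R by simp
      also have "\<dots> \<le> (R * R) ^ n3"
      proof (rule power_mono)
        have "4 * R \<le> R * R" using R by (intro mult_right_mono) auto
        then show "R + 2 \<le> R * R" using R(1) by linarith
      qed (use R in auto)
      also have "\<dots> = q" by (simp add: q_def power_mult power2_eq_square)
      finally have "real T * \<bar>poly P R\<bar> \<le> R * q" using R by (intro mult_mono) auto
      moreover have Rq: "4 * 1 \<le> R * q" using R q by (intro mult_mono) auto
      moreover have "4 * (R * q) \<le> R * (R * q)" using R Rq by (intro mult_right_mono) auto
      ultimately have in1: "real T * \<bar>poly P R\<bar> + 1 \<le> R * (R * q)" by simp
      have w: "4 * 4 \<le> R * (R * q)" using R Rq by (intro mult_mono) auto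
      have "2 * R * d * (real T * \<bar>poly P R\<bar> + 1) \<le> R * R * R * (R * (R * q))"
        using R d1 in1 by (intro mult_mono) auto
      moreover have "4 * 4 * 4 * (4 * 4) \<le> R * R * R * (R * (R * q))"
        using R Rq w by (intro mult_mono) auto
      moreover have "4 * (R * R * R * (R * (R * q))) \<le> R * (R * R * R * (R * (R * q)))"
        using R q by (intro mult_right_mono) auto
      moreover have "R * (R * R * R * (R * (R * q))) = R ^ j"
        by (simp add: j_def q_def power_add eval_nat_numeral)
      ultimately show "X \<le> R ^ j" unfolding X_def by linarith
    qed
    also have "ln (R ^ j) = real j * real m * ln y"
      using y by (simp add: R_def ln_realpow)
    also have "ln y \<le> (1 + ln a / ln 2) * ln (real T + 1)"
    proof -
      have "y \<le> a * (real T + 1)"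
        using mult_right_mono[of 1 a "real T"] a by (simp add: y_def algebra_simps)
      then have "ln y \<le> ln (a * (real T + 1))" using y by (subst ln_le_cancel_iff) auto
      also have "\<dots> = ln a + ln (real T + 1)" using a by (simp add: ln_mult)
      also have "ln a \<le> ln a / ln 2 * ln (real T + 1)"
      proof -
        have "ln a * ln 2 \<le> ln a * ln (real T + 1)" using a T by (intro mult_left_mono) auto
        then show ?thesis by (simp add: field_simps)
      qed
      finally show ?thesis by (simp add: algebra_simps)
    qed
    also have "d * (real j * real m * ((1 + ln a / ln 2) * ln (real T + 1))) + 3
        \<le> C * ln (real T + 1)"
    proof -
      have "ln 2 \<le> ln (real T + 1)" using T by simp
      then have "3 \<le> 3 / ln 2 * ln (real T + 1)" by (simp add: field_simps)
      then show ?thesis by (simp add: C_def algebra_simps)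
    qed
    finally show "(\<integral>Z. env T Z \<partial>law T) - (\<integral>Z. ln (dens T \<theta>s Z / dens T \<theta>b Z) \<partial>law T)
        \<le> C * ln (real T + 1)" using d1 by (simp add: mult_left_mono)
  qed
qed

section \<open>Passage to the prior and the quantities of the statement\<close>

lemma ln_seq_dens_swap:
  assumes "\<theta> \<in> \<Theta>" "\<theta>' \<in> \<Theta>"
  shows "ln (seq_dens p T \<theta> Z / seq_dens p T \<theta>' Z) = - ln (seq_dens p T \<theta>' Z / seq_dens p T \<theta> Z)"
  using seq_dens_supp[OF assms, of T Z] seq_dens_supp[OF assms(2,1), of T Z]
    seq_dens_nonneg[OF assms(1), of T Z] seq_dens_nonneg[OF assms(2), of T Z]
  by (cases "seq_dens p T \<theta> Z = 0") (auto simp: ln_div less_le)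

lemma expected_posterior_renyi_le:
  fixes \<pi> :: "'a \<Rightarrow> real"
  assumes T: "1 \<le> T" and r: "0 < r" "r < 1"
    and prior_meas: "(\<lambda>\<theta>. indicator \<Theta> \<theta> * \<pi> \<theta>) \<in> borel_measurable lborel"
    and prior_nonneg: "\<forall>\<theta>\<in>\<Theta>. 0 \<le> \<pi> \<theta>"
    and prior_int: "(\<integral>\<^sup>+ \<theta>. indicator \<Theta> \<theta> * ennreal (\<pi> \<theta>) \<partial>lborel) = 1"
    and dom: "dominated_family (N T) (dens T) \<theta>s \<theta>b (env T)"
    and C: "0 \<le> C" "(\<integral>Z. env T Z \<partial>law T) - (\<integral>Z. ln (dens T \<theta>s Z / dens T \<theta>b Z) \<partial>law T) \<le> C"
  defines "E \<equiv> (\<integral>\<^sup>+ \<theta>. indicator \<Theta> \<theta> * ennreal (\<pi> \<theta> * exp_neg_cross p T \<theta>s \<theta>b \<theta>) \<partial>lborel)"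
  assumes E: "0 < E"
  shows "enn2ereal (\<integral>\<^sup>+ Z. post_expect p \<Theta> \<pi> T Z (\<lambda>\<theta>. renyi_T p r T \<theta> \<theta>s) \<partial>seq_law p T \<theta>s)
    \<le> ereal (- (1 + r) / ((1 - r) * real T) * ln (enn2real E)
        + (1 + r) / (1 - r) * KL_divergence (exp 1) (seq_law p T \<theta>b) (seq_law p T \<theta>s) / real T
        + C / real T)"
proof -
  define \<mu> where "\<mu> = density lborel (\<lambda>\<theta>. ennreal (indicator \<Theta> \<theta> * \<pi> \<theta>))"
  have w: "ennreal (indicator \<Theta> \<theta> * \<pi> \<theta>) = indicator \<Theta> \<theta> * ennreal (\<pi> \<theta>)" for \<theta>
    by (auto simp: indicator_def)
  have [simp, measurable_cong]: "sets \<mu> = sets lborel" by (simp add: \<mu>_def)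
  have nn_\<mu>: "(\<integral>\<^sup>+ \<theta>. F \<theta> \<partial>\<mu>) = (\<integral>\<^sup>+ \<theta>. indicator \<Theta> \<theta> * ennreal (\<pi> \<theta>) * F \<theta> \<partial>lborel)"
    if "F \<in> borel_measurable \<mu>" for F
    unfolding \<mu>_def w[symmetric] using that prior_meas by (intro nn_integral_density) auto
  have "emeasure \<mu> (space \<mu>) = (\<integral>\<^sup>+ \<theta>. 1 \<partial>\<mu>)" by simp
  also have "\<dots> = 1" by (subst nn_\<mu>) (auto simp: prior_int)
  finally have "prob_space \<mu>" by (rule prob_spaceI)
  then interpret B: bayes_family "N T" "dens T" \<theta>s \<theta>b "env T" \<mu>
    using dom dens_joint[of T]
    by (intro bayes_family.intro bayes_family_axioms.intro)
       (simp_all cong: measurable_cong_sets sets_pair_measure_cong)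
  define c where "c = 1 / (real T * (1 - r))"
  have c: "0 \<le> c" using r by (simp add: c_def)
  have renyi: "renyi_T p r T \<theta> \<theta>s = ennreal (c * - ln (B.affinity r \<theta>))" if \<theta>: "\<theta> \<in> \<Theta>" for \<theta>
  proof -
    have "(\<integral>\<^sup>+ Z. ennreal (\<Prod>t<T. (p t (restrict Z {..<t}) \<theta> (Z t)
              / p t (restrict Z {..<t}) \<theta>s (Z t)) powr r) \<partial>seq_law p T \<theta>s)
        = (\<integral>\<^sup>+ Z. ennreal ((dens T \<theta> Z / dens T \<theta>s Z) powr r) \<partial>law T)"
      using \<theta> true_task
      by (simp add: law_eq dens_eq seq_dens_def prod_powr_distrib flip: prod_dividef)
    then show ?thesis
      using B.affinity_pos[OF r, of \<theta>]
      by (simp add: renyi_T_def B.nn_integral_ratio_powr[OF r] c_def)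
  qed
  have E_eq: "E = (\<integral>\<^sup>+ \<theta>. ennreal (B.exp_llr \<theta>) \<partial>\<mu>)"
  proof -
    have "exp_neg_cross p T \<theta>s \<theta>b \<theta> = B.exp_llr \<theta>" if \<theta>: "\<theta> \<in> \<Theta>" for \<theta>
    proof -
      \<comment> \<open>Common support makes the positivity clause of \<open>exp_neg_cross\<close>
        automatic; what remains is integrability, as in \<open>exp_llr\<close>, with the ratio
        inverted and the sign changed.\<close>
      have "AE Z in seq_law p T \<theta>s. 0 < seq_dens p T \<theta> Z"
        unfolding law_eq[symmetric] using AE_law_pos[of T] by eventually_elim (use \<theta> in \<open>auto simp flip: dens_eq\<close>)
      then show ?thesis
        using \<theta> ref_task
        by (simp add: exp_neg_cross_def Let_def ln_seq_dens_swap[OF ref_task \<theta>] B.exp_llr_def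
            B.mean_llr_def law_eq dens_eq)
    qed
    then have "E = (\<integral>\<^sup>+ \<theta>. indicator \<Theta> \<theta> * ennreal (\<pi> \<theta>) * ennreal (B.exp_llr \<theta>) \<partial>lborel)"
      unfolding E_def using prior_nonneg
      by (intro nn_integral_cong) (auto simp: indicator_def ennreal_mult)
    also have "\<dots> = (\<integral>\<^sup>+ \<theta>. ennreal (B.exp_llr \<theta>) \<partial>\<mu>)"
      by (rule nn_\<mu>[symmetric]) measurable
    finally show ?thesis .
  qed
  have post: "post_expect p \<Theta> \<pi> T Z (\<lambda>\<theta>. renyi_T p r T \<theta> \<theta>s)
      = (\<integral>\<^sup>+ \<theta>. ennreal (dens T \<theta> Z) * ennreal (c * - ln (B.affinity r \<theta>)) \<partial>\<mu>)
        / (\<integral>\<^sup>+ \<theta>. ennreal (dens T \<theta> Z) \<partial>\<mu>)" if Z: "Z \<in> space (N T)" for Z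
  proof -
    note Z [measurable]
    have "(\<integral>\<^sup>+ \<theta>. indicator \<Theta> \<theta> * ennreal (\<pi> \<theta> * seq_dens p T \<theta> Z) * renyi_T p r T \<theta> \<theta>s \<partial>lborel)
      = (\<integral>\<^sup>+ \<theta>. indicator \<Theta> \<theta> * ennreal (\<pi> \<theta>)
          * (ennreal (dens T \<theta> Z) * ennreal (c * - ln (B.affinity r \<theta>))) \<partial>lborel)"
      using prior_nonneg
      by (intro nn_integral_cong)
         (auto simp: indicator_def renyi dens_eq ennreal_mult seq_dens_nonneg mult.assoc)
    also have "\<dots> = (\<integral>\<^sup>+ \<theta>. ennreal (dens T \<theta> Z) * ennreal (c * - ln (B.affinity r \<theta>)) \<partial>\<mu>)"
      by (rule nn_\<mu>[symmetric]) measurable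
    moreover have "(\<integral>\<^sup>+ \<theta>. indicator \<Theta> \<theta> * ennreal (\<pi> \<theta> * seq_dens p T \<theta> Z) \<partial>lborel)
      = (\<integral>\<^sup>+ \<theta>. indicator \<Theta> \<theta> * ennreal (\<pi> \<theta>) * ennreal (dens T \<theta> Z) \<partial>lborel)"
      using prior_nonneg
      by (intro nn_integral_cong) (auto simp: indicator_def dens_eq ennreal_mult seq_dens_nonneg)
    moreover have "\<dots> = (\<integral>\<^sup>+ \<theta>. ennreal (dens T \<theta> Z) \<partial>\<mu>)"
      by (rule nn_\<mu>[symmetric]) measurable
    ultimately show ?thesis by (simp add: post_expect_def)
  qed
  have KL: "KL_divergence (exp 1) (seq_law p T \<theta>b) (seq_law p T \<theta>s) = B.kl"
    using KL_eq[of T \<theta>b] ref_task by (simp add: B.kl_def law_eq seq_law_def dens_eq)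
  have K: "0 < (\<integral>\<^sup>+ \<theta>. ennreal (B.exp_llr \<theta>) \<partial>\<mu>)" using E E_eq by simp
  have C': "(\<integral>Z. env T Z \<partial>law T) - B.kl \<le> C" using C by (simp add: B.kl_def)
  let ?y = "c * ((1 - r) * C + (1 + r) * (B.kl - ln (enn2real E)))"
  have "(\<integral>\<^sup>+ Z. post_expect p \<Theta> \<pi> T Z (\<lambda>\<theta>. renyi_T p r T \<theta> \<theta>s) \<partial>seq_law p T \<theta>s)
      = (\<integral>\<^sup>+ Z. (\<integral>\<^sup>+ \<theta>. ennreal (dens T \<theta> Z) * ennreal (c * - ln (B.affinity r \<theta>)) \<partial>\<mu>)
        / (\<integral>\<^sup>+ \<theta>. ennreal (dens T \<theta> Z) \<partial>\<mu>) \<partial>law T)"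
    unfolding law_eq[symmetric] by (intro nn_integral_cong post) simp
  also have "\<dots> \<le> ennreal ?y"
    unfolding E_eq by (rule B.posterior_renyi_bound[OF r K C' c])
  finally have "enn2ereal (\<integral>\<^sup>+ Z. post_expect p \<Theta> \<pi> T Z (\<lambda>\<theta>. renyi_T p r T \<theta> \<theta>s) \<partial>seq_law p T \<theta>s)
      \<le> enn2ereal (ennreal ?y)" by (simp add: less_eq_ennreal.rep_eq)
  \<comment> \<open>\<open>ennreal\<close> would truncate a negative bound to 0, so the sign of the
    right-hand side has to be known; it follows from \<open>ln E \<le> kl\<close> and
    \<open>0 \<le> C\<close>.\<close>
  also have "\<dots> = ereal ?y"
  proof (rule enn2ereal_ennreal)
    have "ln (enn2real E) \<le> B.kl" unfolding E_eq by (rule B.ln_nn_integral_exp_llr_le[OF r K])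
    then show "0 \<le> ?y" using c C r by (intro mult_nonneg_nonneg add_nonneg_nonneg) auto
  qed
  also have "?y = - (1 + r) / ((1 - r) * real T) * ln (enn2real E) + (1 + r) / (1 - r) * B.kl / real T
        + C / real T"
    using T r by (simp add: c_def divide_simps) (simp add: algebra_simps)
  finally show ?thesis by (simp only: KL)
qed

end

theorem theoremD1:
  fixes p :: "nat \<Rightarrow> (nat \<Rightarrow> 'z::euclidean_space) \<Rightarrow> 'a::euclidean_space \<Rightarrow> 'z \<Rightarrow> real"
    and \<Theta> :: "'a set" and \<theta>s \<theta>b :: 'a and r :: real
  assumes Theta_meas: "\<Theta> \<in> sets lborel"
    and true_task: "\<theta>s \<in> \<Theta>" and ref_task: "\<theta>b \<in> \<Theta>"
    \<comment> \<open>each p_t(. | z_{1:t-1}, \<theta>) is a probability density (jointly measurable)\<close>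
    and dens_nonneg: "\<And>t h \<theta> z. \<theta> \<in> \<Theta> \<Longrightarrow> 0 \<le> p t (restrict h {..<t}) \<theta> z"
    and dens_int: "\<And>t h \<theta>. \<theta> \<in> \<Theta> \<Longrightarrow>
                     (\<integral>\<^sup>+ z. ennreal (p t (restrict h {..<t}) \<theta> z) \<partial>lborel) = 1"
    and dens_meas: "\<And>t. (\<lambda>(\<theta>, x). indicator \<Theta> \<theta> * p t (restrict x {..<t}) \<theta> (x t))
                       \<in> borel_measurable (lborel \<Otimes>\<^sub>M PiM {..<Suc t} (\<lambda>_. lborel))"
    \<comment> \<open>Assumption (DG)(i): tails\<close>
    and DG_tails: "\<exists>k::real. 1 \<le> k \<and> (\<exists>P::real poly. \<forall>T::nat. \<forall>R::real. 1 \<le> T \<longrightarrow> real T \<le> R \<longrightarrow>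
          prob_le (seq_law p T \<theta>s)
            {Z. ennreal (seq_dens p T \<theta>b Z) \<le> (SUP \<theta>\<in>{\<theta>\<in>\<Theta>. R \<le> norm \<theta>}. ennreal (seq_dens p T \<theta> Z))}
            (poly P (real T) / (1 + R powr (1 / k)))
        \<and> prob_le (seq_law p T \<theta>s) {Z. \<exists>t<T. R \<le> norm (Z t)}
            (poly P (real T) / (1 + R powr (1 / k))))"
    \<comment> \<open>Assumption (DG)(ii): moments\<close>
    and DG_moments: "\<exists>P::real poly. \<forall>T::nat. 1 \<le> T \<longrightarrow>
          (AE Z in seq_law p T \<theta>s. 0 < seq_dens p T \<theta>b Z
                \<and> bdd_above ((\<lambda>\<theta>. seq_dens p T \<theta> Z / seq_dens p T \<theta>b Z) ` \<Theta>))
        \<and> (\<integral>\<^sup>+ Z. ennreal ((ln (SUP \<theta>\<in>\<Theta>. seq_dens p T \<theta> Z / seq_dens p T \<theta>b Z))\<^sup>2)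
              \<partial>seq_law p T \<theta>s) \<le> ennreal (poly P (real T))"
    \<comment> \<open>Assumption (DG)(iii): regularity, log-ratio bound written multiplicatively\<close>
    and DG_regular: "\<exists>P::real poly. \<forall>t::nat. \<forall>R::real. \<forall>\<theta>\<in>\<Theta>. \<forall>\<theta>'\<in>\<Theta>. \<forall>h z.
          0 < R \<longrightarrow> norm \<theta> \<le> R \<longrightarrow> norm \<theta>' \<le> R \<longrightarrow> (\<forall>s<t. norm (h s) \<le> R) \<longrightarrow> norm z \<le> R \<longrightarrow>
          p t (restrict h {..<t}) \<theta> z
            \<le> exp (poly P R * norm (\<theta> - \<theta>')) * p t (restrict h {..<t}) \<theta>' z"
    and r: "0 < r" "r < 1"
  shows "\<exists>C::real. \<forall>\<pi>::'a \<Rightarrow> real.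
           (\<lambda>\<theta>. indicator \<Theta> \<theta> * \<pi> \<theta>) \<in> borel_measurable lborel \<longrightarrow> (\<forall>\<theta>\<in>\<Theta>. 0 \<le> \<pi> \<theta>) \<longrightarrow>
           (\<integral>\<^sup>+ \<theta>. indicator \<Theta> \<theta> * ennreal (\<pi> \<theta>) \<partial>lborel) = 1 \<longrightarrow> 0 < \<pi> \<theta>b \<longrightarrow>
           (\<forall>T::nat. 1 \<le> T \<longrightarrow>
              (let E\<pi> = (\<integral>\<^sup>+ \<theta>. indicator \<Theta> \<theta> * ennreal (\<pi> \<theta> * exp_neg_cross p T \<theta>s \<theta>b \<theta>) \<partial>lborel)
               in 0 < E\<pi> \<longrightarrow>
                  enn2ereal (\<integral>\<^sup>+ Z. post_expect p \<Theta> \<pi> T Z (\<lambda>\<theta>. renyi_T p r T \<theta> \<theta>s)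
                                \<partial>seq_law p T \<theta>s)
                  \<le> ereal (- (1 + r) / ((1 - r) * real T) * ln (enn2real E\<pi>)
                           + (1 + r) / (1 - r) * KL_divergence (exp 1) (seq_law p T \<theta>b) (seq_law p T \<theta>s) / real T
                           + C * ln (real T + 1) / real T)))"
proof -
  obtain k P1 where k: "1 \<le> k" and tails: "\<And>T R. 1 \<le> T \<Longrightarrow> real T \<le> R \<Longrightarrow>
          prob_le (seq_law p T \<theta>s)
            {Z. ennreal (seq_dens p T \<theta>b Z) \<le> (SUP \<theta>\<in>{\<theta>\<in>\<Theta>. R \<le> norm \<theta>}. ennreal (seq_dens p T \<theta> Z))}
            (poly P1 (real T) / (1 + R powr (1 / k)))
        \<and> prob_le (seq_law p T \<theta>s) {Z. \<exists>t<T. R \<le> norm (Z t)}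
            (poly P1 (real T) / (1 + R powr (1 / k)))"
    using DG_tails by blast
  obtain P2 where moments: "\<And>T. 1 \<le> T \<Longrightarrow> AE Z in seq_law p T \<theta>s. 0 < seq_dens p T \<theta>b Z
                \<and> bdd_above ((\<lambda>\<theta>. seq_dens p T \<theta> Z / seq_dens p T \<theta>b Z) ` \<Theta>)"
    and moment2: "\<And>T. 1 \<le> T \<Longrightarrow>
        (\<integral>\<^sup>+ Z. ennreal ((ln (SUP \<theta>\<in>\<Theta>. seq_dens p T \<theta> Z / seq_dens p T \<theta>b Z))\<^sup>2)
              \<partial>seq_law p T \<theta>s) \<le> ennreal (poly P2 (real T))"
    using DG_moments by blast
  obtain P where regular: "\<forall>t::nat. \<forall>R::real. \<forall>\<theta>\<in>\<Theta>. \<forall>\<theta>'\<in>\<Theta>. \<forall>h z.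
          0 < R \<longrightarrow> norm \<theta> \<le> R \<longrightarrow> norm \<theta>' \<le> R \<longrightarrow> (\<forall>s<t. norm (h s) \<le> R) \<longrightarrow> norm z \<le> R \<longrightarrow>
          p t (restrict h {..<t}) \<theta> z
            \<le> exp (poly P R * norm (\<theta> - \<theta>')) * p t (restrict h {..<t}) \<theta>' z"
    using DG_regular by blast
  interpret seq_model p \<Theta> \<theta>s \<theta>b P
    by (rule seq_model.intro) (fact assms regular)+
  \<comment> \<open>\<open>C\<close> is obtained from the model before any prior or horizon is
    fixed, which is the uniformity claimed for the O-term.\<close>
  obtain C where C: "0 \<le> C" "\<And>T. 1 \<le> T \<Longrightarrow>
    (\<integral>Z. env T Z \<partial>law T) - (\<integral>Z. ln (dens T \<theta>s Z / dens T \<theta>b Z) \<partial>law T) \<le> C * ln (real T + 1)"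
    using expected_env_le_ln[OF k tails moments moment2] by blast
  show ?thesis
  proof (intro exI[of _ C] allI impI, unfold Let_def, intro impI)
    fix \<pi> :: "'a \<Rightarrow> real" and T :: nat
    assume "(\<lambda>\<theta>. indicator \<Theta> \<theta> * \<pi> \<theta>) \<in> borel_measurable lborel" "\<forall>\<theta>\<in>\<Theta>. 0 \<le> \<pi> \<theta>"
      "(\<integral>\<^sup>+ \<theta>. indicator \<Theta> \<theta> * ennreal (\<pi> \<theta>) \<partial>lborel) = 1" and T: "1 \<le> T"
      and "0 < (\<integral>\<^sup>+ \<theta>. indicator \<Theta> \<theta> * ennreal (\<pi> \<theta> * exp_neg_cross p T \<theta>s \<theta>b \<theta>) \<partial>lborel)"
    moreover have "0 \<le> C * ln (real T + 1)" using C(1) by simp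
    ultimately show "enn2ereal (\<integral>\<^sup>+ Z. post_expect p \<Theta> \<pi> T Z (\<lambda>\<theta>. renyi_T p r T \<theta> \<theta>s) \<partial>seq_law p T \<theta>s)
      \<le> ereal (- (1 + r) / ((1 - r) * real T)
            * ln (enn2real (\<integral>\<^sup>+ \<theta>. indicator \<Theta> \<theta> * ennreal (\<pi> \<theta> * exp_neg_cross p T \<theta>s \<theta>b \<theta>) \<partial>lborel))
          + (1 + r) / (1 - r) * KL_divergence (exp 1) (seq_law p T \<theta>b) (seq_law p T \<theta>s) / real T
          + C * ln (real T + 1) / real T)"
      using r C(2)[OF T] dominated[OF moments[OF T] moment2[OF T]] by (intro expected_posterior_renyi_le)
  qed
qed

end
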